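(* Let $n\ge 1$ be an integer and let $\mathcal{A}(T,T^* )$ be the unital algebra of operators on the $2^n$-dimensional complex inner product space $V$ generated by $T$ and $T^*$. Then $\mathcal{A}(T,T^* )$ is a $*$-algebra whose decomposition into matrix algebras has components indexed by $0\le\alpha\le\lfloor n/2\rfloor$, with degrees $d_\alpha=n+1-2\alpha$ and multiplicities $m_\alpha=\binom{n}{\alpha}-\binom{n}{\alpha-1}$ (so $m_0=1$). Consequently: (a) the degree of the algebra is $\displaystyle\sum_{\alpha=0}^{\lfloor n/2\rfloor}\left[\binom{n}{\alpha}-\binom{n}{\alpha-1}\right](n+1-2\alpha)=2^n$; (b) the dimension of the algebra is $\displaystyle\sum_{\alpha=0}^{\lfloor n/2\rfloor}(n+1-2\alpha)^2=\binom{n+3}{3}$; (c) the dimension of the center of the algebra is $1+\lfloor n/2\rfloor$; (d) the dimension of the centralizer of the algebra (in the algebra of all linear operators on $V$) is $\displaystyle\sum_{\alpha=0}^{\lfloor n/2\rfloor}\left[\binom{n}{\alpha}-\binom{n}{\alpha-1}\right]^2=\frac{1}{n+1}\binom{2n}{n}=C_n$, the $n$-th Catalan number.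
   Context: Let $V$ be the complex inner product space with orthonormal basis $\{e_I\}$ indexed by all subsets $I\subseteq\{1,\dots,n\}$. For each $i$ let $e_i$ denote the linear operator on $V$ with $e_i\,e_I=e_{I\cup\{i\}}$ if $i\notin I$ and $e_i\,e_I=0$ if $i\in I$; its adjoint $\delta_i=e_i^*$ satisfies $\delta_i e_I=e_{I\setminus\{i\}}$ if $i\in I$ and $0$ otherwise. Put $T=\sum_{i=1}^n e_i$ and $T^*=\sum_{i=1}^n\delta_i$. A unital $*$-algebra $\mathcal{A}$ of operators on a finite-dimensional complex inner product space is, up to unitary equivalence, of the form $\{\bigoplus_i A_i\otimes I_{m_i}: A_i\in M_{d_i}(\mathbb{C})\}$; the $d_i$ are the degrees and the $m_i$ the multiplicities of the components. The degree of $\mathcal{A}$ is $\sum_i m_id_i$, its dimension is $\sum_i d_i^2$, the dimension of its centralizer is $\sum_i m_i^2$, and the dimension of its center is the number of components. By convention $\binom{n}{-1}=0$. *)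

theory Defs
  imports "HOL-Analysis.Analysis"
begin

text \<open>
  The space V is \<^typ>\<open>complex ^ ('n::finite set)\<close>, where the finite type \<open>'n\<close> with
  \<open>CARD('n) = n\<close> plays the role of \<open>{1..n}\<close> and \<open>axis I 1\<close> is the basis vector \<open>e_I\<close>. Linear
  operators are represented by their matrices with respect to this orthonormal basis,
  acting by \<open>*v\<close>.
\<close>

definition cinner :: "complex ^ 'm::finite \<Rightarrow> complex ^ 'm \<Rightarrow> complex" where
  "cinner v w = (\<Sum>i\<in>UNIV. v $ i * cnj (w $ i))"

definition adj :: "complex ^ 'm::finite ^ 'm \<Rightarrow> complex ^ 'm ^ 'm" where
  "adj A = (\<chi> i j. cnj (A $ j $ i))"

lemma cinner_adj: "cinner (A *v v) w = cinner v (adj A *v w)"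
proof -
  have "cinner (A *v v) w = (\<Sum>i\<in>UNIV. \<Sum>j\<in>UNIV. A $ i $ j * v $ j * cnj (w $ i))"
    by (simp add: cinner_def matrix_vector_mult_def sum_distrib_right)
  also have "\<dots> = (\<Sum>j\<in>UNIV. \<Sum>i\<in>UNIV. A $ i $ j * v $ j * cnj (w $ i))"
    by (rule sum.swap)
  also have "\<dots> = cinner v (adj A *v w)"
    by (simp add: cinner_def adj_def matrix_vector_mult_def sum_distrib_left mult_ac)
  finally show ?thesis .
qed

lemma cinner_axis:
  "cinner (axis i 1) (axis j 1 :: complex ^ 'm::finite) = (if i = j then 1 else 0)"
  by (simp add: cinner_def axis_def if_distrib[of cnj] if_distrib[of "\<lambda>x. _ * x"] cong: if_cong)

definition unitary :: "complex ^ 'm::finite ^ 'm \<Rightarrow> bool" where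
  "unitary U \<longleftrightarrow> U ** adj U = mat 1 \<and> adj U ** U = mat 1"

definition cscale :: "complex \<Rightarrow> complex ^ 'm::finite ^ 'm \<Rightarrow> complex ^ 'm ^ 'm" where
  "cscale c A = (\<chi> i j. c * A $ i $ j)"

text \<open>Thus \<open>cmat.dim\<close> is the dimension over the complex numbers.\<close>

global_interpretation cmat: vector_space "cscale :: complex \<Rightarrow> complex ^ 'm::finite ^ 'm \<Rightarrow> _"
  by unfold_locales (simp_all add: cscale_def vec_eq_iff algebra_simps)

definition unital_subalgebra :: "(complex ^ 'm::finite ^ 'm) set \<Rightarrow> bool" where
  "unital_subalgebra \<A> \<longleftrightarrow> mat 1 \<in> \<A> \<and>
     (\<forall>A\<in>\<A>. \<forall>B\<in>\<A>. A + B \<in> \<A>) \<and> (\<forall>c. \<forall>A\<in>\<A>. cscale c A \<in> \<A>) \<and>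
     (\<forall>A\<in>\<A>. \<forall>B\<in>\<A>. A ** B \<in> \<A>)"

definition generated_algebra :: "(complex ^ 'm::finite ^ 'm) set \<Rightarrow> (complex ^ 'm ^ 'm) set" where
  "generated_algebra S = unital_subalgebra hull S"

definition star_algebra :: "(complex ^ 'm::finite ^ 'm) set \<Rightarrow> bool" where
  "star_algebra \<A> \<longleftrightarrow> unital_subalgebra \<A> \<and> (\<forall>A\<in>\<A>. adj A \<in> \<A>)"

definition centralizer :: "(complex ^ 'm::finite ^ 'm) set \<Rightarrow> (complex ^ 'm ^ 'm) set" where
  "centralizer \<A> = {X. \<forall>A\<in>\<A>. X ** A = A ** X}"

definition center :: "(complex ^ 'm::finite ^ 'm) set \<Rightarrow> (complex ^ 'm ^ 'm) set" where
  "center \<A> = \<A> \<inter> centralizer \<A>"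

text \<open>
  A labelling \<open>\<phi>\<close> identifies the index type \<open>'m\<close> with the triples \<open>(i, j, k)\<close>, where \<open>i \<in> K\<close>,
  \<open>j < d i\<close>, \<open>k < m i\<close>, that index the standard basis of the direct sum over \<open>i \<in> K\<close> of
  \<open>\<complex>^(d i) \<otimes> \<complex>^(m i)\<close>. Under this identification \<open>block_matrix \<phi> M\<close> is the direct sum of
  the matrices \<open>M i \<otimes> 1\<close>; only the entries \<open>M i j j'\<close> with \<open>j, j' < d i\<close> matter.
\<close>

definition block_index :: "'i set \<Rightarrow> ('i \<Rightarrow> nat) \<Rightarrow> ('i \<Rightarrow> nat) \<Rightarrow> ('i \<times> nat \<times> nat) set" where
  "block_index K d m = (SIGMA i:K. {..<d i} \<times> {..<m i})"

definition block_matrix ::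
  "('m::finite \<Rightarrow> 'i \<times> nat \<times> nat) \<Rightarrow> ('i \<Rightarrow> nat \<Rightarrow> nat \<Rightarrow> complex) \<Rightarrow> complex ^ 'm ^ 'm" where
  "block_matrix \<phi> M = (\<chi> r c. case (\<phi> r, \<phi> c) of
     ((i, j, k), (i', j', k')) \<Rightarrow> if i = i' \<and> k = k' then M i j j' else 0)"

definition decomposes_as ::
  "(complex ^ 'm::finite ^ 'm) set \<Rightarrow> 'i set \<Rightarrow> ('i \<Rightarrow> nat) \<Rightarrow> ('i \<Rightarrow> nat) \<Rightarrow> bool" where
  "decomposes_as \<A> K d m \<longleftrightarrow> (\<forall>i\<in>K. d i \<ge> 1 \<and> m i \<ge> 1) \<and>
     (\<exists>\<phi> U. bij_betw \<phi> UNIV (block_index K d m) \<and> unitary U \<and>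
        \<A> = {U ** block_matrix \<phi> M ** adj U | M. True})"

text \<open>
  The value does not depend on the decomposition: any one gives the cardinality of
  the set of triples, hence the dimension of the underlying space.
\<close>

definition algebra_degree :: "(complex ^ 'm::finite ^ 'm) set \<Rightarrow> nat" where
  "algebra_degree \<A> =
     (THE N. \<exists>(K :: nat set) d m. decomposes_as \<A> K d m \<and> N = (\<Sum>i\<in>K. m i * d i))"

definition e_op :: "'n::finite \<Rightarrow> complex ^ ('n set) ^ ('n set)" where
  "e_op i = (\<chi> I J. if i \<notin> J \<and> I = insert i J then 1 else 0)"

definition \<delta>_op :: "'n::finite \<Rightarrow> complex ^ ('n set) ^ ('n set)" where
  "\<delta>_op i = adj (e_op i)"

lemma matrix_axis: "A *v axis j 1 = (\<chi> i. A $ i $ j)" for A :: "complex ^ 'm::finite ^ 'm"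
  by (simp add: matrix_vector_mult_def axis_def if_distrib[of "\<lambda>x. _ * x"] cong: if_cong)

lemma e_op_axis: "e_op i *v axis I 1 = (if i \<in> I then 0 else axis (I \<union> {i}) 1)"
  unfolding matrix_axis by (auto simp: vec_eq_iff e_op_def axis_def)

lemma \<delta>_op_axis: "\<delta>_op i *v axis I 1 = (if i \<in> I then axis (I - {i}) 1 else 0)"
  unfolding matrix_axis by (auto simp: vec_eq_iff \<delta>_op_def adj_def e_op_def axis_def)

definition T_op :: "complex ^ ('n::finite set) ^ ('n set)" where
  "T_op = (\<Sum>i\<in>UNIV. e_op i)"

definition Tstar_op :: "complex ^ ('n::finite set) ^ ('n set)" where
  "Tstar_op = (\<Sum>i\<in>UNIV. \<delta>_op i)"

text \<open>
  Natural-number subtraction is exact for \<open>\<alpha> \<le> n div 2\<close>. The conditional encodes the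
  convention that the binomial coefficient with lower index \<open>-1\<close> is zero.
\<close>

definition comp_degree :: "nat \<Rightarrow> nat \<Rightarrow> nat" where
  "comp_degree n \<alpha> = n + 1 - 2 * \<alpha>"

definition comp_mult :: "nat \<Rightarrow> nat \<Rightarrow> nat" where
  "comp_mult n \<alpha> = (n choose \<alpha>) - (if \<alpha> = 0 then 0 else n choose (\<alpha> - 1))"

fun catalan :: "nat \<Rightarrow> nat" where
  "catalan 0 = 1"
| "catalan (Suc n) = (\<Sum>i\<le>n. catalan i * catalan (n - i))"

end

theory Submission imports Defs begin

text \<open>
  The commutator of \<open>T\<^sup>*\<close> and \<open>T\<close> is diagonal: it acts on \<open>e_I\<close> as multiplication by \<open>n - 2|I|\<close>,
  so \<open>V\<close> is a representation of \<open>sl\<^sub>2\<close>. Comparing the number of equations with the number of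
  unknowns, the kernel of \<open>T\<^sup>*\<close> on the span of the \<open>e_I\<close> with \<open>|I| = \<alpha>\<close> contains \<open>m\<^sub>\<alpha>\<close>
  orthonormal vectors. Applying normalized powers of \<open>T\<close> to them yields an orthonormal family of
  \<open>\<Sum> m\<^sub>\<alpha> d\<^sub>\<alpha> = 2^n\<close> vectors, hence an orthonormal basis of \<open>V\<close>, in which \<open>T\<close> and \<open>T\<^sup>*\<close>
  are block matrices. Conversely \<open>T T\<^sup>*\<close> and \<open>T\<^sup>* T\<close> are diagonal in this basis and together
  separate the pairs \<open>(\<alpha>, j)\<close>, so polynomials in them give all diagonal matrix units; \<open>T\<close> and
  \<open>T\<^sup>*\<close> connect neighbouring ones, and every block matrix is obtained.
\<close>

section \<open>Binomial and Catalan identities\<close>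

lemma comp_mult_real:
  assumes "\<alpha> \<le> n div 2"
  shows "real (comp_mult n \<alpha>) = real (n choose \<alpha>) - (if \<alpha> = 0 then 0 else real (n choose (\<alpha> - 1)))"
proof (cases "\<alpha> = 0")
  case False
  then have "n choose (\<alpha> - 1) \<le> n choose \<alpha>"
    using assms by (intro binomial_mono) auto
  then show ?thesis using False by (simp add: comp_mult_def of_nat_diff)
qed (simp add: comp_mult_def)

text \<open>Binomial coefficients increase strictly up to the middle of the row. Positivity is part
  of \<open>decomposes_as\<close>, so no component is empty.\<close>

lemma comp_mult_pos:
  assumes "\<alpha> \<le> n div 2"
  shows "comp_mult n \<alpha> \<ge> 1"
proof (cases "\<alpha> = 0")
  case False
  then have "n choose (\<alpha> - 1) < n choose \<alpha>"
    using assms by (intro binomial_strict_mono) auto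
  then show ?thesis using False by (simp add: comp_mult_def)
qed (simp add: comp_mult_def)

text \<open>The reflection i -> n + 1 - i carries the lower half of {0..n+1} onto the upper half.
  For odd n its fixed point (n + 1) / 2 lies in neither half, so the summand has to vanish
  there.\<close>

lemma sum_half_symmetric:
  fixes f :: "nat \<Rightarrow> real"
  assumes sym: "\<And>i. i \<le> n + 1 \<Longrightarrow> f (n + 1 - i) = f i"
    and mid: "\<And>i. 2 * i = n + 1 \<Longrightarrow> f i = 0"
  shows "2 * (\<Sum>i=0..n div 2. f i) = (\<Sum>i=0..n+1. f i)"
proof -
  let ?L = "{0..n div 2}" and ?R = "{n + 1 - n div 2..n+1}"
  have R: "(\<Sum>i\<in>?R. f i) = (\<Sum>i\<in>?L. f i)"
    by (rule sum.reindex_bij_witness[where i = "\<lambda>i. n + 1 - i" and j = "\<lambda>i. n + 1 - i"])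
      (use sym in auto)
  have "(\<Sum>i=0..n+1. f i) = (\<Sum>i\<in>?L \<union> ?R. f i)"
  proof (rule sum.mono_neutral_right)
    show "\<forall>i\<in>{0..n + 1} - (?L \<union> ?R). f i = 0"
    proof
      fix i assume "i \<in> {0..n + 1} - (?L \<union> ?R)"
      then have "2 * i = n + 1" by auto
      then show "f i = 0" by (rule mid)
    qed
  qed auto
  also have "\<dots> = (\<Sum>i\<in>?L. f i) + (\<Sum>i\<in>?R. f i)"
    by (rule sum.union_disjoint) auto
  finally show ?thesis using R by simp
qed

text \<open>The multiplicities extend to a sequence that is antisymmetric under
  \<open>i \<mapsto> n + 1 - i\<close>, so that half sums become sums over the full binomial row.\<close>

definition binomial_step :: "nat \<Rightarrow> nat \<Rightarrow> real" where
  "binomial_step n i = real (n choose i) - (if i = 0 then 0 else real (n choose (i - 1)))"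

text \<open>The symmetry of the binomial row exchanges the two terms of the difference.\<close>

lemma binomial_step_antisym:
  assumes "i \<le> n + 1"
  shows "binomial_step n (n + 1 - i) = - binomial_step n i"
proof -
  \<comment> \<open>The two ends are split off because the default value at index 0 enters there, on
    one side or the other.\<close>
  consider "i = 0" | "i = n + 1" | j where "i = Suc j" "j < n"
    using assms by (metis Suc_eq_plus1 le_eq_less_or_eq less_Suc_eq_le not0_implies_Suc Suc_less_eq)
  then show ?thesis
  proof cases
    case 3
    then have "n choose (n - j) = n choose j" "n choose (n - Suc j) = n choose (Suc j)"
      using binomial_symmetric[of j n] binomial_symmetric[of "Suc j" n] by auto
    moreover have "n + 1 - i - 1 = n - Suc j" "n + 1 - i = n - j" "n - j \<noteq> 0"
      using 3 by auto
    ultimately show ?thesis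
      using 3 by (simp add: binomial_step_def)
  qed (auto simp: binomial_step_def)
qed

lemma binomial_step_mid: "2 * i = n + 1 \<Longrightarrow> binomial_step n i = 0"
  using binomial_step_antisym[of i n] by (metis add_diff_cancel_right' equal_neg_zero le_add1 mult_2)

lemma comp_mult_binomial_step: "\<alpha> \<le> n div 2 \<Longrightarrow> real (comp_mult n \<alpha>) = binomial_step n \<alpha>"
  by (simp add: comp_mult_real binomial_step_def)

text \<open>Both factors change sign under reflection, so twice the half sum is a sum over the full
  row. Shifting the index in the subtracted part turns the weight n + 1 - 2i into n - 1 - 2i; the
  weights then differ by 2, which leaves twice the row sum.\<close>

lemma sum_mult_degree:
  "(\<Sum>\<alpha>=0..n div 2. comp_mult n \<alpha> * comp_degree n \<alpha>) = 2 ^ n"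
proof -
  let ?f = "\<lambda>i. binomial_step n i * (real n + 1 - 2 * real i)"
  have row: "(\<Sum>i=0..n. real (n choose i)) = 2 ^ n"
    using choose_row_sum[of n] by (metis atMost_atLeast0 of_nat_numeral of_nat_power of_nat_sum)
  have "2 * real (\<Sum>\<alpha>=0..n div 2. comp_mult n \<alpha> * comp_degree n \<alpha>) = 2 * (\<Sum>i=0..n div 2. ?f i)"
    by (auto simp: comp_mult_binomial_step comp_degree_def of_nat_diff intro!: sum.cong)
  also have "\<dots> = (\<Sum>i=0..n+1. ?f i)"
  proof (rule sum_half_symmetric)
    fix i assume "i \<le> n + 1"
    then show "?f (n + 1 - i) = ?f i"
      by (simp only: binomial_step_antisym) (simp add: of_nat_diff algebra_simps)
  qed (simp add: binomial_step_mid)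
  also have "\<dots> = (\<Sum>i=0..n+1. real (n choose i) * (real n + 1 - 2 * real i))
      - (\<Sum>i=0..n+1. (if i = 0 then 0 else real (n choose (i - 1))) * (real n + 1 - 2 * real i))"
    unfolding sum_subtractf[symmetric] by (simp add: binomial_step_def left_diff_distrib)
  also have "(\<Sum>i=0..n+1. (if i = 0 then 0 else real (n choose (i - 1))) * (real n + 1 - 2 * real i))
      = (\<Sum>i=0..n. real (n choose i) * (real n - 1 - 2 * real i))"
    unfolding Suc_eq_plus1[symmetric] sum.atLeast0_atMost_Suc_shift
    by (auto simp: algebra_simps intro!: sum.cong)
  also have "(\<Sum>i=0..n+1. real (n choose i) * (real n + 1 - 2 * real i))
      = (\<Sum>i=0..n. real (n choose i) * (real n + 1 - 2 * real i))"
    by simp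
  also have "(\<Sum>i=0..n. real (n choose i) * (real n + 1 - 2 * real i))
      - (\<Sum>i=0..n. real (n choose i) * (real n - 1 - 2 * real i)) = 2 * (\<Sum>i=0..n. real (n choose i))"
    unfolding sum_subtractf[symmetric] sum_distrib_left by (auto simp: algebra_simps intro!: sum.cong)
  finally have "real (\<Sum>\<alpha>=0..n div 2. comp_mult n \<alpha> * comp_degree n \<alpha>) = real (2 ^ n)"
    using row by simp
  then show ?thesis by (simp only: of_nat_eq_iff)
qed

text \<open>Passing from n to n + 2 shifts the degrees by one index and adds only the new leading
  term (n + 3)^2, hence the induction in steps of two.\<close>

lemma sum_degree_squares: "(\<Sum>\<alpha>=0..n div 2. (comp_degree n \<alpha>)\<^sup>2) = (n + 3) choose 3"
proof (induction n rule: induct_nat_012)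
  case (ge2 n)
  have "(\<Sum>\<alpha>=0..Suc (Suc n) div 2. (comp_degree (Suc (Suc n)) \<alpha>)\<^sup>2)
      = (n + 3)\<^sup>2 + (\<Sum>\<alpha>=0..n div 2. (comp_degree n \<alpha>)\<^sup>2)"
    unfolding div2_Suc_Suc sum.atLeast0_atMost_Suc_shift by (simp add: comp_degree_def)
  also have "\<dots> = (n + 3)\<^sup>2 + ((n + 3) choose 3)"
    using ge2 by simp
  also have "\<dots> = (Suc (Suc n) + 3) choose 3"
  proof -
    \<comment> \<open>Two Pascal steps leave the binomials (n+4 choose 2) and (n+3 choose 2), whose
      sum is (n + 3)^2.\<close>
    have "2 * (n + 3 choose 2) = (n + 3) * (n + 2)" "2 * (n + 4 choose 2) = (n + 4) * (n + 3)"
      by (simp_all add: choose_two)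
    moreover have "n + 5 choose 3 = (n + 4 choose 2) + ((n + 3 choose 2) + (n + 3 choose 3))"
      by (simp add: eval_nat_numeral)
    ultimately show ?thesis
      by (simp add: power2_eq_square algebra_simps eval_nat_numeral)
  qed
  finally show ?case .
qed (auto simp: comp_degree_def numeral_eq_Suc)

text \<open>Squares of an antisymmetric sequence are symmetric, so twice the sum runs over the full
  row. Expanding the square gives two sums equal to (2n choose n) and a cross term which Vandermonde
  turns into (2n choose n-1). The difference of these two binomials is the Catalan quotient.\<close>

lemma sum_mult_squares:
  "real (\<Sum>\<alpha>=0..n div 2. (comp_mult n \<alpha>)\<^sup>2) = 1 / (real n + 1) * real ((2 * n) choose n)"
proof (cases "n = 0")
  case False
  have A: "(\<Sum>i=0..n+1. (real (n choose i))\<^sup>2) = real (2 * n choose n)"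
    using choose_square_sum[of n] by (simp add: atMost_atLeast0 flip: of_nat_sum of_nat_power)
  have B: "(\<Sum>i=0..n+1. (if i = 0 then 0 else real (n choose (i - 1)))\<^sup>2) = real (2 * n choose n)"
    using choose_square_sum[of n]
    unfolding Suc_eq_plus1[symmetric] sum.atLeast0_atMost_Suc_shift
    by (simp add: atMost_atLeast0 flip: of_nat_sum of_nat_power)
  have "(\<Sum>i=0..n+1. real (n choose i) * (if i = 0 then 0 else real (n choose (i - 1))))
      = (\<Sum>i=0..n. real (n choose Suc i) * real (n choose i))"
    unfolding Suc_eq_plus1[symmetric] sum.atLeast0_atMost_Suc_shift by simp
  also have "\<dots> = (\<Sum>i=0..n-1. real (n choose Suc i) * real (n choose i))"
    using False by (intro sum.mono_neutral_right) auto
  also have "\<dots> = real (\<Sum>i\<le>n-1. (n choose i) * (n choose (n - 1 - i)))"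
    unfolding of_nat_sum atMost_atLeast0
  proof (rule sum.cong)
    fix i assume "i \<in> {0..n-1}"
    then have "n - Suc i = n - 1 - i" "Suc i \<le> n" using False by auto
    then show "real (n choose Suc i) * real (n choose i) = real ((n choose i) * (n choose (n - 1 - i)))"
      using binomial_symmetric[of "Suc i" n] by simp
  qed auto
  also have "(\<Sum>i\<le>n-1. (n choose i) * (n choose (n - 1 - i))) = (n + n) choose (n - 1)"
    by (rule vandermonde)
  finally have C: "(\<Sum>i=0..n+1. real (n choose i) * (if i = 0 then 0 else real (n choose (i - 1))))
      = real (2 * n choose (n - 1))" by (simp add: mult_2)
  have "2 * real (\<Sum>\<alpha>=0..n div 2. (comp_mult n \<alpha>)\<^sup>2) = 2 * (\<Sum>i=0..n div 2. (binomial_step n i)\<^sup>2)"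
    by (auto simp: comp_mult_binomial_step intro!: sum.cong)
  also have "\<dots> = (\<Sum>i=0..n+1. (binomial_step n i)\<^sup>2)"
    by (rule sum_half_symmetric) (simp_all only: binomial_step_antisym binomial_step_mid, simp_all)
  also have "\<dots> = (\<Sum>i=0..n+1. (real (n choose i))\<^sup>2)
      + (\<Sum>i=0..n+1. (if i = 0 then 0 else real (n choose (i - 1)))\<^sup>2)
      - 2 * (\<Sum>i=0..n+1. real (n choose i) * (if i = 0 then 0 else real (n choose (i - 1))))"
    unfolding sum_distrib_left sum_subtractf[symmetric] sum.distrib[symmetric]
    by (intro sum.cong) (auto simp: binomial_step_def power2_eq_square algebra_simps)
  finally have 1: "real (\<Sum>\<alpha>=0..n div 2. (comp_mult n \<alpha>)\<^sup>2)
      = real (2 * n choose n) - real (2 * n choose (n - 1))"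
    unfolding A B C by simp
  \<comment> \<open>The ratio of neighbouring central coefficients; the factor 2n - (n - 1) is n +
    1.\<close>
  have "n * (2 * n choose n) = (2 * n - (n - 1)) * (2 * n choose (n - 1))"
    using False binomial_absorb_comp[of "2 * n" "n - 1"] Suc_times_binomial_add[of n n]
      binomial_absorption[of "n - 1" "2 * n"] by simp
  then have "real n * real (2 * n choose n) = (real n + 1) * real (2 * n choose (n - 1))"
    using False by (simp add: algebra_simps flip: of_nat_mult of_nat_add)
  then show ?thesis unfolding 1 by (simp add: field_simps)
qed (simp add: comp_mult_def)

text \<open>Both sides equal 1 at n = 0 and are multiplied by 2(2n + 1)/(n + 1) when n grows by one.
  The recurrence is proved with the denominator cleared, and n + 1 is cancelled at the end.\<close>

lemma gbinomial_half:
  "((1/2 :: real) gchoose (n + 1)) * (2 * (-4) ^ n) * (real n + 1) = real ((2 * n) choose n)"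
proof (induction n)
  case (Suc n)
  let ?g = "\<lambda>k. (1/2 :: real) gchoose k"
  have g: "?g (Suc n + 1) * (real n + 2) = - (2 * real n + 1) / 2 * ?g (n + 1)"
    using gbinomial_mult_1[of "1/2 :: real" "n + 1"] by (simp add: algebra_simps)
  have "Suc n * (2 * Suc n choose Suc n) = 2 * (Suc n * (2 * n + 1 choose n))"
    using Suc_times_binomial[of n "2 * n + 1"] by (simp del: binomial_Suc_Suc)
  also have "Suc n * (2 * n + 1 choose n) = (2 * n + 1) * (2 * n choose n)"
    using binomial_absorb_comp[of "2 * n + 1" n] by simp
  finally have "real (Suc n * (2 * Suc n choose Suc n)) = real (2 * ((2 * n + 1) * (2 * n choose n)))"
    by (simp only:)
  then have c: "(real n + 1) * real (2 * Suc n choose Suc n) = 2 * (2 * real n + 1) * real (2 * n choose n)"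
    by (simp only: of_nat_mult of_nat_Suc of_nat_add of_nat_numeral) (simp add: algebra_simps)
  have "?g (Suc n + 1) * (2 * (-4) ^ Suc n) * (real (Suc n) + 1)
      = (?g (Suc n + 1) * (real n + 2)) * (2 * (-4) ^ Suc n)"
    by (simp add: algebra_simps)
  also have "\<dots> = 2 * (2 * real n + 1) * (?g (n + 1) * (2 * (-4) ^ n))"
    unfolding g by (simp add: algebra_simps)
  finally have "(real n + 1) * (?g (Suc n + 1) * (2 * (-4) ^ Suc n) * (real (Suc n) + 1))
      = 2 * (2 * real n + 1) * (?g (n + 1) * (2 * (-4) ^ n) * (real n + 1))"
    by (simp add: mult_ac)
  also have "\<dots> = (real n + 1) * real (2 * Suc n choose Suc n)"
    unfolding Suc.IH c ..
  finally show ?case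
    by (metis mult_left_cancel of_nat_Suc of_nat_neq_0 add.commute)
qed simp

text \<open>With the Catalan numbers written as binomial coefficients of \<open>1/2\<close>, their recursion is
  Vandermonde's identity for \<open>1/2 + 1/2 = 1\<close>.\<close>

lemma catalan_gbinomial: "real (catalan n) = ((1/2 :: real) gchoose (n + 1)) * (2 * (-4) ^ n)"
proof (induction n rule: catalan.induct)
  case (2 n)
  let ?g = "\<lambda>k. (1/2 :: real) gchoose k"
  have "(\<Sum>k\<le>n + 2. ?g k * ?g (n + 2 - k)) = (1 gchoose (n + 2))"
    using gbinomial_Vandermonde[of "1/2 :: real" "1/2" "n + 2"] by (simp add: atMost_atLeast0)
  also have "\<dots> = 0"
    using binomial_gbinomial[of 1 "n + 2", where ?'a = real] by simp
  \<comment> \<open>The convolution for n + 2 has two more terms than the Catalan recursion. These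
    end terms each equal \<open>?g (n + 2)\<close> because \<open>?g 0\<close> is 1, so the inner
    part is -2 times it.\<close>
  finally have "0 = ?g 0 * ?g (n + 2) + (\<Sum>k\<le>n. ?g (k + 1) * ?g (n - k + 1)) + ?g (n + 2) * ?g 0"
    by (simp add: sum.atMost_Suc_shift[of _ "Suc n"] sum.atMost_Suc[of _ n] Suc_diff_le del: sum.atMost_Suc)
  then have V: "(\<Sum>k\<le>n. ?g (k + 1) * ?g (n - k + 1)) = - 2 * ?g (n + 2)"
    by simp
  have "real (catalan (Suc n)) = (\<Sum>i\<le>n. (?g (i + 1) * (2 * (-4) ^ i)) * (?g (n - i + 1) * (2 * (-4) ^ (n - i))))"
    using 2 by simp
  also have "\<dots> = (\<Sum>i\<le>n. (4 * (-4) ^ n) * (?g (i + 1) * ?g (n - i + 1)))"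
  proof (rule sum.cong)
    fix i assume "i \<in> {..n}"
    then have "(-4 :: real) ^ n = (-4) ^ i * (-4) ^ (n - i)"
      by (simp flip: power_add)
    then show "(?g (i + 1) * (2 * (-4) ^ i)) * (?g (n - i + 1) * (2 * (-4) ^ (n - i)))
        = (4 * (-4) ^ n) * (?g (i + 1) * ?g (n - i + 1))" by simp
  qed simp
  finally show ?case
    unfolding sum_distrib_left[symmetric] V by simp
qed simp

lemma catalan_closed: "1 / (real n + 1) * real ((2 * n) choose n) = real (catalan n)"
  unfolding catalan_gbinomial gbinomial_half[symmetric]
  by (simp add: field_simps add_pos_pos)

section \<open>Algebras of block matrices\<close>

lemma cscale_nth [simp]: "cscale c A $ i $ j = c * A $ i $ j"
  by (simp add: cscale_def)

lemma adj_nth [simp]: "adj A $ i $ j = cnj (A $ j $ i)"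
  by (simp add: adj_def)

lemma adj_adj [simp]: "adj (adj A) = A"
  by (simp add: vec_eq_iff)

lemma adj_matrix_mult: "adj (A ** B) = adj B ** adj A"
  by (simp add: vec_eq_iff matrix_matrix_mult_def mult.commute)

lemma adj_sum: "adj (\<Sum>x\<in>X. A x) = (\<Sum>x\<in>X. adj (A x))"
  by (simp add: vec_eq_iff)

lemma cscale_matrix_mult: "cscale c A ** B = cscale c (A ** B)" "A ** cscale c B = cscale c (A ** B)"
  by (simp_all add: vec_eq_iff matrix_matrix_mult_def sum_distrib_left mult_ac)

definition conj_by :: "complex ^ 'm::finite ^ 'm \<Rightarrow> complex ^ 'm ^ 'm \<Rightarrow> complex ^ 'm ^ 'm" where
  "conj_by U X = U ** X ** adj U"

lemma conj_by_0 [simp]: "conj_by U 0 = 0"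
  by (simp add: conj_by_def matrix_matrix_mult_def vec_eq_iff)

lemma conj_by_add: "conj_by U (X + Y) = conj_by U X + conj_by U Y"
  by (simp add: vec_eq_iff conj_by_def matrix_matrix_mult_def algebra_simps sum.distrib)

lemma conj_by_cscale: "conj_by U (cscale c X) = cscale c (conj_by U X)"
  by (simp add: conj_by_def cscale_matrix_mult)

lemma conj_by_sum: "conj_by U (\<Sum>x\<in>S. f x) = (\<Sum>x\<in>S. conj_by U (f x))"
  by (induction S rule: infinite_finite_induct) (simp_all add: conj_by_add)

lemma adj_conj_by: "adj (conj_by U X) = conj_by U (adj X)"
  by (simp add: conj_by_def adj_matrix_mult matrix_mul_assoc)

lemma conj_by_mult:
  assumes "unitary U"
  shows "conj_by U X ** conj_by U Y = conj_by U (X ** Y)"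
proof -
  have "conj_by U X ** conj_by U Y = U ** X ** (adj U ** U) ** Y ** adj U"
    by (simp only: conj_by_def matrix_mul_assoc)
  also have "\<dots> = U ** X ** Y ** adj U"
    using assms by (simp add: unitary_def)
  finally show ?thesis by (simp only: conj_by_def matrix_mul_assoc)
qed

lemma conj_by_mat_1: "unitary U \<Longrightarrow> conj_by U (mat 1) = mat 1"
  by (simp add: conj_by_def unitary_def)

lemma unitary_adj: "unitary U \<Longrightarrow> unitary (adj U)"
  by (simp add: unitary_def)

lemma conj_by_inverse:
  assumes "unitary U"
  shows "conj_by U (conj_by (adj U) X) = X"
proof -
  have "conj_by U (conj_by (adj U) X) = (U ** adj U) ** X ** (U ** adj U)"
    by (simp only: conj_by_def adj_adj matrix_mul_assoc)
  then show ?thesis using assms by (simp add: unitary_def)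
qed

lemma conj_by_inject:
  assumes "unitary U"
  shows "conj_by U X = conj_by U Y \<longleftrightarrow> X = Y"
  using conj_by_inverse[OF unitary_adj[OF assms], unfolded adj_adj] by metis

section \<open>Dimensions of spaces of patterned matrices\<close>

definition pattern :: "('m::finite \<Rightarrow> 'm \<Rightarrow> 'x option) \<Rightarrow> ('x \<Rightarrow> complex) \<Rightarrow> complex ^ 'm ^ 'm" where
  "pattern g f = (\<chi> r c. case g r c of None \<Rightarrow> 0 | Some x \<Rightarrow> f x)"

text \<open>All entries with the same label share one free value, and entries without a label
  vanish. The 0/1 matrices of the occurring labels have disjoint nonempty supports, so they form a
  basis, and unitary conjugation preserves this. The algebra, its centralizer and its center are all
  measured in this way, with three different labellings.\<close>

lemma dim_pattern:
  fixes g :: "'m::finite \<Rightarrow> 'm \<Rightarrow> 'x option"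
  assumes U: "unitary U" and X: "X = {x. \<exists>r c. g r c = Some x}"
  shows "cmat.dim {conj_by U (pattern g f) | f. True} = card X"
proof -
  define E where "E x = conj_by U (pattern g (\<lambda>y. if y = x then 1 else 0))" for x
  have "finite (range (\<lambda>(r, c). g r c))" by simp
  moreover have "Some ` X \<subseteq> range (\<lambda>(r, c). g r c)"
  proof
    fix y assume "y \<in> Some ` X"
    then obtain r c where "y = (\<lambda>(r, c). g r c) (r, c)" by (auto simp: X dest: sym)
    then show "y \<in> range (\<lambda>(r, c). g r c)" by (rule range_eqI)
  qed
  ultimately have "finite (Some ` X)" by (rule rev_finite_subset)
  then have fin: "finite X" by (simp add: finite_image_iff)
  have expand: "pattern g f = (\<Sum>x\<in>X. cscale (f x) (pattern g (\<lambda>y. if y = x then 1 else 0)))" for f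
  proof (intro vec_eq_iff[THEN iffD2] allI)
    fix r c
    show "pattern g f $ r $ c = (\<Sum>x\<in>X. cscale (f x) (pattern g (\<lambda>y. if y = x then 1 else 0))) $ r $ c"
    proof (cases "g r c")
      case (Some x)
      then have "x \<in> X" by (auto simp: X)
      then show ?thesis using Some fin by (simp add: pattern_def if_distrib[of "\<lambda>x. _ * x"] cong: if_cong)
    qed (simp add: pattern_def)
  qed
  have comb: "(\<Sum>x\<in>X. cscale (f x) (E x)) = conj_by U (pattern g f)" for f
    by (subst expand) (simp add: conj_by_sum conj_by_cscale E_def)
  have inj: "f x = h x" if "conj_by U (pattern g f) = conj_by U (pattern g h)" "x \<in> X" for f h x
  proof -
    obtain r c where rc: "g r c = Some x" using \<open>x \<in> X\<close> by (auto simp: X)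
    have "pattern g f $ r $ c = pattern g h $ r $ c"
      using that U by (simp add: conj_by_inject)
    then show ?thesis by (simp add: pattern_def rc)
  qed
  have inj_E: "inj_on E X"
  proof
    \<comment> \<open>Equal basis matrices have equal coefficients at the label x, which forces the
      labels to agree.\<close>
    fix x y assume "x \<in> X" "y \<in> X" "E x = E y"
    then have "(if x = x then 1 else 0 :: complex) = (if x = y then 1 else 0)"
      unfolding E_def by (rule_tac inj)
    then show "x = y" by (auto split: if_splits)
  qed
  have zero: "pattern g (\<lambda>_. 0) = 0"
    by (auto simp: pattern_def vec_eq_iff split: option.split)
  show ?thesis
  proof (rule cmat.dim_unique)
    show "E ` X \<subseteq> {conj_by U (pattern g f) | f. True}"
      by (auto simp: E_def)
    show "{conj_by U (pattern g f) | f. True} \<subseteq> cmat.span (E ` X)"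
    proof clarify
      fix f
      have "(\<Sum>x\<in>X. cscale (f x) (E x)) \<in> cmat.span (E ` X)"
        by (intro cmat.span_sum cmat.span_scale) (auto intro: cmat.span_base)
      then show "conj_by U (pattern g f) \<in> cmat.span (E ` X)" by (simp add: comb)
    qed
    show "card (E ` X) = card X" using inj_E by (rule card_image)
    have "u v = 0" if "(\<Sum>v\<in>E ` X. cscale (u v) v) = 0" "v \<in> E ` X" for u v
    proof -
      obtain x where x: "x \<in> X" "v = E x" using \<open>v \<in> E ` X\<close> by blast
      have "conj_by U (pattern g (\<lambda>x. u (E x))) = conj_by U (pattern g (\<lambda>_. 0))"
        using that(1) by (simp add: sum.reindex[OF inj_E] comb zero)
      then show ?thesis using inj[of "\<lambda>x. u (E x)" "\<lambda>_. 0" x] x by simp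
    qed
    then show "cmat.independent (E ` X)"
      using fin by (auto simp: cmat.dependent_finite)
  qed
qed

section \<open>Well-definedness of the degree\<close>

lemma decomposes_as_card:
  fixes \<A> :: "(complex ^ 'm::finite ^ 'm) set"
  assumes "decomposes_as \<A> K d m"
  shows "(\<Sum>i\<in>K. m i * d i) = CARD('m)"
proof -
  from assms obtain \<phi> :: "'m \<Rightarrow> _" where bij: "bij_betw \<phi> UNIV (block_index K d m)"
    and pos: "\<And>i. i \<in> K \<Longrightarrow> d i \<ge> 1 \<and> m i \<ge> 1"
    unfolding decomposes_as_def by blast
  have fin: "finite (block_index K d m)"
    using bij_betw_finite[OF bij] by simp
  \<comment> \<open>Finiteness of K is inherited from the index set: as d i and m i are positive,
    each i occurs in the triple (i, 0, 0).\<close>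
  have "K \<subseteq> fst ` block_index K d m"
  proof
    fix i assume "i \<in> K"
    then have "(i, 0, 0) \<in> block_index K d m"
      using pos[of i] by (auto simp: block_index_def)
    then show "i \<in> fst ` block_index K d m" by force
  qed
  then have "finite K" using fin by (meson finite_imageI finite_subset)
  then have "card (block_index K d m) = (\<Sum>i\<in>K. m i * d i)"
    unfolding block_index_def by (subst card_SigmaI) (auto simp: card_cartesian_product mult.commute)
  then show ?thesis using bij_betw_same_card[OF bij] by simp
qed

text \<open>Every decomposition counts the same basis of the space, so the description in
  \<open>algebra_degree\<close> has a unique value.\<close>

lemma algebra_degree_eq:
  fixes \<A> :: "(complex ^ 'm::finite ^ 'm) set" and K :: "nat set"
  assumes "decomposes_as \<A> K d m"
  shows "algebra_degree \<A> = (\<Sum>i\<in>K. m i * d i)"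
  unfolding algebra_degree_def
proof (rule the_equality)
  show "\<exists>(K' :: nat set) d' m'. decomposes_as \<A> K' d' m' \<and> (\<Sum>i\<in>K. m i * d i) = (\<Sum>i\<in>K'. m' i * d' i)"
    using assms by blast
next
  fix N assume "\<exists>(K' :: nat set) d' m'. decomposes_as \<A> K' d' m' \<and> N = (\<Sum>i\<in>K'. m' i * d' i)"
  then obtain K' :: "nat set" and d' m'
    where "decomposes_as \<A> K' d' m'" "N = (\<Sum>i\<in>K'. m' i * d' i)" by blast
  then show "N = (\<Sum>i\<in>K. m i * d i)"
    using decomposes_as_card[OF assms] decomposes_as_card by simp
qed

section \<open>The full block algebra in a fixed unitary frame\<close>

locale block_frame =
  fixes \<phi> :: "'m::finite \<Rightarrow> 'i \<times> nat \<times> nat" and K d m and U :: "complex ^ 'm ^ 'm"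
  assumes bij: "bij_betw \<phi> UNIV (block_index K d m)"
    and unitary: "unitary U"
    and finite_K: "finite K"
    and pos: "\<And>i. i \<in> K \<Longrightarrow> d i \<ge> 1 \<and> m i \<ge> 1"
begin

definition \<psi> :: "'i \<times> nat \<times> nat \<Rightarrow> 'm" where "\<psi> = inv_into UNIV \<phi>"

lemma \<phi>_\<psi> [simp]: "i \<in> K \<Longrightarrow> j < d i \<Longrightarrow> k < m i \<Longrightarrow> \<phi> (\<psi> (i, j, k)) = (i, j, k)"
  unfolding \<psi>_def by (rule bij_betw_inv_into_right[OF bij]) (simp add: block_index_def)

lemma \<psi>_\<phi> [simp]: "\<psi> (\<phi> r) = r"
  unfolding \<psi>_def by (rule bij_betw_inv_into_left[OF bij UNIV_I])

lemma label_cases: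
  obtains i j k where "r = \<psi> (i, j, k)" "i \<in> K" "j < d i" "k < m i"
proof -
  obtain i j k where "\<phi> r = (i, j, k)" by (cases "\<phi> r")
  moreover have "\<phi> r \<in> block_index K d m" using bij_betwE[OF bij] by simp
  moreover have "r = \<psi> (\<phi> r)" by simp
  ultimately show thesis using that by (auto simp: block_index_def)
qed

lemma matrix_eqI:
  assumes "\<And>i j k i' j' k'. \<lbrakk>i \<in> K; j < d i; k < m i; i' \<in> K; j' < d i'; k' < m i'\<rbrakk>
    \<Longrightarrow> X $ \<psi> (i, j, k) $ \<psi> (i', j', k') = Y $ \<psi> (i, j, k) $ \<psi> (i', j', k')"
  shows "X = Y"
  unfolding vec_eq_iff
proof (intro allI)
  fix r c
  obtain i j k where r: "r = \<psi> (i, j, k)" "i \<in> K" "j < d i" "k < m i" by (rule label_cases)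
  obtain i' j' k' where c: "c = \<psi> (i', j', k')" "i' \<in> K" "j' < d i'" "k' < m i'" by (rule label_cases)
  show "X $ r $ c = Y $ r $ c" unfolding r(1) c(1) by (rule assms) (fact r c)+
qed

lemma sum_labels: "(\<Sum>r\<in>UNIV. f r) = (\<Sum>i\<in>K. \<Sum>j<d i. \<Sum>k<m i. f (\<psi> (i, j, k)))"
proof -
  have "(\<Sum>r\<in>UNIV. f r) = (\<Sum>r\<in>UNIV. f (\<psi> (\<phi> r)))" by simp
  also have "\<dots> = (\<Sum>x\<in>block_index K d m. f (\<psi> x))"
    by (rule sum.reindex_bij_betw[OF bij])
  also have "\<dots> = (\<Sum>i\<in>K. \<Sum>jk\<in>{..<d i} \<times> {..<m i}. f (\<psi> (i, jk)))"
    unfolding block_index_def using finite_K by (subst sum.Sigma) auto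
  also have "\<dots> = (\<Sum>i\<in>K. \<Sum>j<d i. \<Sum>k<m i. f (\<psi> (i, j, k)))"
    by (simp add: sum.cartesian_product case_prod_beta')
  finally show ?thesis .
qed

definition block_op :: "('i \<Rightarrow> nat \<Rightarrow> nat \<Rightarrow> complex) \<Rightarrow> complex ^ 'm ^ 'm" where
  "block_op M = conj_by U (block_matrix \<phi> M)"

lemma block_matrix_nth:
  "\<lbrakk>i \<in> K; j < d i; k < m i; i' \<in> K; j' < d i'; k' < m i'\<rbrakk> \<Longrightarrow>
    block_matrix \<phi> M $ \<psi> (i, j, k) $ \<psi> (i', j', k') = (if i = i' \<and> k = k' then M i j j' else 0)"
  by (simp add: block_matrix_def)

lemma sum_labels_delta:
  assumes "i \<in> K" "k < m i"
  shows "(\<Sum>i'\<in>K. \<Sum>l<d i'. \<Sum>k'<m i'. if i' = i \<and> k' = k then F l else 0) = (\<Sum>l<d i. F l)"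
proof -
  have "(\<Sum>i'\<in>K. \<Sum>l<d i'. \<Sum>k'<m i'. if i' = i \<and> k' = k then F l else 0)
      = (\<Sum>i'\<in>K. if i' = i then \<Sum>l<d i'. F l else 0)"
    using assms by (intro sum.cong refl) auto
  then show ?thesis using assms finite_K by simp
qed

text \<open>A block matrix links only labels with the same i and k, so of the sum over all triples
  only the sum over the middle index survives.\<close>

lemma block_matrix_mult_nth:
  assumes "i \<in> K" "j < d i" "k < m i" "i' \<in> K" "j' < d i'" "k' < m i'"
  shows "(block_matrix \<phi> M ** X) $ \<psi> (i, j, k) $ \<psi> (i', j', k')
      = (\<Sum>l<d i. M i j l * X $ \<psi> (i, l, k) $ \<psi> (i', j', k'))"
    and "(X ** block_matrix \<phi> M) $ \<psi> (i, j, k) $ \<psi> (i', j', k')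
      = (\<Sum>l<d i'. X $ \<psi> (i, j, k) $ \<psi> (i', l, k') * M i' l j')"
proof -
  have "(block_matrix \<phi> M ** X) $ \<psi> (i, j, k) $ \<psi> (i', j', k')
    = (\<Sum>i1\<in>K. \<Sum>l<d i1. \<Sum>k1<m i1. if i1 = i \<and> k1 = k then
        M i j l * X $ \<psi> (i, l, k) $ \<psi> (i', j', k') else 0)"
    unfolding matrix_matrix_mult_def vec_lambda_beta sum_labels using assms
    by (intro sum.cong refl) (auto simp: block_matrix_nth)
  then show "(block_matrix \<phi> M ** X) $ \<psi> (i, j, k) $ \<psi> (i', j', k')
      = (\<Sum>l<d i. M i j l * X $ \<psi> (i, l, k) $ \<psi> (i', j', k'))"
    using assms by (simp only: sum_labels_delta)
  have "(X ** block_matrix \<phi> M) $ \<psi> (i, j, k) $ \<psi> (i', j', k')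
    = (\<Sum>i1\<in>K. \<Sum>l<d i1. \<Sum>k1<m i1. if i1 = i' \<and> k1 = k' then
        X $ \<psi> (i, j, k) $ \<psi> (i', l, k') * M i' l j' else 0)"
    unfolding matrix_matrix_mult_def vec_lambda_beta sum_labels using assms
    by (intro sum.cong refl) (auto simp: block_matrix_nth)
  then show "(X ** block_matrix \<phi> M) $ \<psi> (i, j, k) $ \<psi> (i', j', k')
      = (\<Sum>l<d i'. X $ \<psi> (i, j, k) $ \<psi> (i', l, k') * M i' l j')"
    using assms by (simp only: sum_labels_delta)
qed

lemma block_op_cong:
  assumes "\<And>i j j'. \<lbrakk>i \<in> K; j < d i; j' < d i\<rbrakk> \<Longrightarrow> M i j j' = N i j j'"
  shows "block_op M = block_op N"
  unfolding block_op_def by (rule arg_cong[where f = "conj_by U"], rule matrix_eqI) (auto simp: block_matrix_nth assms)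

lemma block_op_add: "block_op M + block_op N = block_op (\<lambda>i j j'. M i j j' + N i j j')"
  unfolding block_op_def conj_by_add[symmetric]
  by (rule arg_cong[where f = "conj_by U"], rule matrix_eqI) (auto simp: block_matrix_nth)

lemma block_op_cscale: "cscale c (block_op M) = block_op (\<lambda>i j j'. c * M i j j')"
  unfolding block_op_def conj_by_cscale[symmetric]
  by (rule arg_cong[where f = "conj_by U"], rule matrix_eqI) (auto simp: block_matrix_nth)

lemma block_op_mult: "block_op M ** block_op N = block_op (\<lambda>i j j'. \<Sum>l<d i. M i j l * N i l j')"
  unfolding block_op_def conj_by_mult[OF unitary]
proof (rule arg_cong[where f = "conj_by U"], rule matrix_eqI)
  fix i j k i' j' k'
  assume A: "i \<in> K" "j < d i" "k < m i" "i' \<in> K" "j' < d i'" "k' < m i'"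
  then show "(block_matrix \<phi> M ** block_matrix \<phi> N) $ \<psi> (i, j, k) $ \<psi> (i', j', k')
    = block_matrix \<phi> (\<lambda>i j j'. \<Sum>l<d i. M i j l * N i l j') $ \<psi> (i, j, k) $ \<psi> (i', j', k')"
    unfolding block_matrix_mult_nth(1)[OF A]
    by (cases "i = i' \<and> k = k'") (auto simp: block_matrix_nth)
qed

lemma adj_block_op: "adj (block_op M) = block_op (\<lambda>i j j'. cnj (M i j' j))"
  unfolding block_op_def adj_conj_by
  by (rule arg_cong[where f = "conj_by U"], rule matrix_eqI) (auto simp: block_matrix_nth)

lemma mat_1_eq_block_op: "mat 1 = block_op (\<lambda>i j j'. if j = j' then 1 else 0)"
proof -
  have "mat 1 = block_matrix \<phi> (\<lambda>i j j'. if j = j' then 1 else 0)"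
  proof (rule matrix_eqI)
    fix i j k i' j' k'
    assume A: "i \<in> K" "j < d i" "k < m i" "i' \<in> K" "j' < d i'" "k' < m i'"
    then have "\<psi> (i, j, k) = \<psi> (i', j', k') \<longleftrightarrow> (i, j, k) = (i', j', k')"
      by (metis \<phi>_\<psi>)
    with A show "mat 1 $ \<psi> (i, j, k) $ \<psi> (i', j', k')
        = block_matrix \<phi> (\<lambda>i j j'. if j = j' then 1 else 0) $ \<psi> (i, j, k) $ \<psi> (i', j', k')"
      by (auto simp: block_matrix_nth mat_def)
  qed
  then show ?thesis by (metis block_op_def conj_by_mat_1 unitary)
qed

lemma star_algebra_range_block_op: "star_algebra (range block_op)"
proof -
  have "mat 1 \<in> range block_op" unfolding mat_1_eq_block_op by (rule rangeI)
  moreover have "block_op M + block_op N \<in> range block_op" "cscale c (block_op M) \<in> range block_op" "block_op M ** block_op N \<in> range block_op"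
    "adj (block_op M) \<in> range block_op" for c M N
    unfolding block_op_add block_op_cscale block_op_mult adj_block_op by (rule rangeI)+
  ultimately show ?thesis
    unfolding star_algebra_def unital_subalgebra_def by blast
qed

lemma decomposes_as_range_block_op: "decomposes_as (range block_op) K d m"
proof -
  have "range block_op = {U ** block_matrix \<phi> M ** adj U | M. True}"
    by (auto simp: block_op_def conj_by_def)
  then show ?thesis
    unfolding decomposes_as_def
    by (intro conjI ballI exI[of _ \<phi>] exI[of _ U]) (simp_all add: pos[simplified] bij unitary)
qed

lemma dim_range_block_op: "cmat.dim (range block_op) = (\<Sum>i\<in>K. (d i)\<^sup>2)"
proof -
  \<comment> \<open>The label forgets k, since a block matrix repeats M i once for every k.\<close>
  define g where "g r c = (case (\<phi> r, \<phi> c) of ((i, j, k), (i', j', k')) \<Rightarrow>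
    if i = i' \<and> k = k' then Some (i, j, j') else None)" for r c
  let ?X = "SIGMA i:K. {..<d i} \<times> {..<d i}"
  have eq: "pattern g f = block_matrix \<phi> (\<lambda>i j j'. f (i, j, j'))" for f
    by (auto simp: block_matrix_def pattern_def g_def vec_eq_iff split: prod.split)
  have "block_op M \<in> {conj_by U (pattern g f) | f. True}" for M
    by (rule CollectI, rule exI[of _ "\<lambda>(i, j, j'). M i j j'"]) (simp add: eq block_op_def)
  then have "range block_op = {conj_by U (pattern g f) | f. True}"
    by (auto simp: eq block_op_def)
  moreover have "?X = {x. \<exists>r c. g r c = Some x}"
  proof (intro set_eqI iffI)
    fix x assume "x \<in> ?X"
    then obtain i j j' where x: "x = (i, j, j')" "i \<in> K" "j < d i" "j' < d i" by auto
    \<comment> \<open>The copy k = 0 exists because m i is positive, so every label is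
      attained.\<close>
    then have "g (\<psi> (i, j, 0)) (\<psi> (i, j', 0)) = Some x" using pos[of i] by (simp add: g_def)
    then show "x \<in> {x. \<exists>r c. g r c = Some x}" by blast
  next
    fix x assume "x \<in> {x. \<exists>r c. g r c = Some x}"
    then obtain r c where "g r c = Some x" by blast
    then show "x \<in> ?X"
      by (cases r rule: label_cases; cases c rule: label_cases) (auto simp: g_def split: if_splits)
  qed
  ultimately have "cmat.dim (range block_op) = card ?X" by (simp only: dim_pattern[OF unitary refl])
  also have "\<dots> = (\<Sum>i\<in>K. (d i)\<^sup>2)"
    using finite_K by (subst card_SigmaI) (auto simp: card_cartesian_product power2_eq_square)
  finally show ?thesis .
qed

section \<open>The centralizer and the center of the block algebra\<close>

definition comm_block :: "('i \<Rightarrow> nat \<Rightarrow> nat \<Rightarrow> complex) \<Rightarrow> complex ^ 'm ^ 'm" where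
  "comm_block N = (\<chi> r c. case (\<phi> r, \<phi> c) of
     ((i, j, k), (i', j', k')) \<Rightarrow> if i = i' \<and> j = j' then N i k k' else 0)"

lemma comm_block_nth:
  "\<lbrakk>i \<in> K; j < d i; k < m i; i' \<in> K; j' < d i'; k' < m i'\<rbrakk> \<Longrightarrow>
    comm_block N $ \<psi> (i, j, k) $ \<psi> (i', j', k') = (if i = i' \<and> j = j' then N i k k' else 0)"
  by (simp add: comm_block_def)

text \<open>Block matrices are direct sums of M i \<otimes> 1 and these are direct sums of 1
  \<otimes> N i: they act on different tensor factors.\<close>

lemma comm_block_commutes: "comm_block N ** block_matrix \<phi> M = block_matrix \<phi> M ** comm_block N"
proof (rule matrix_eqI)
  fix i j k i' j' k'
  assume A: "i \<in> K" "j < d i" "k < m i" "i' \<in> K" "j' < d i'" "k' < m i'"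
  have "(comm_block N ** block_matrix \<phi> M) $ \<psi> (i, j, k) $ \<psi> (i', j', k')
      = (\<Sum>l<d i'. if l = j then if i = i' then N i k k' * M i j j' else 0 else 0)"
    unfolding block_matrix_mult_nth(2)[OF A] using A
    by (intro sum.cong refl) (auto simp: comm_block_nth)
  moreover have "(block_matrix \<phi> M ** comm_block N) $ \<psi> (i, j, k) $ \<psi> (i', j', k')
      = (\<Sum>l<d i. if l = j' then if i = i' then N i k k' * M i j j' else 0 else 0)"
    unfolding block_matrix_mult_nth(1)[OF A] using A
    by (intro sum.cong refl) (auto simp: comm_block_nth)
  ultimately show "(comm_block N ** block_matrix \<phi> M) $ \<psi> (i, j, k) $ \<psi> (i', j', k')
      = (block_matrix \<phi> M ** comm_block N) $ \<psi> (i, j, k) $ \<psi> (i', j', k')"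
    using A by auto
qed

definition matrix_unit :: "'i \<Rightarrow> nat \<Rightarrow> nat \<Rightarrow> 'i \<Rightarrow> nat \<Rightarrow> nat \<Rightarrow> complex" where
  "matrix_unit i a b = (\<lambda>i' j j'. if i' = i \<and> j = a \<and> j' = b then 1 else 0)"

text \<open>Testing against matrix units suffices. The diagonal unit at (i', j') kills the entries
  that change i or j, and the unit from 0 to j identifies the block at j with the reference block at
  0.\<close>

lemma commuting_imp_comm_block:
  assumes comm: "\<And>M. Y ** block_matrix \<phi> M = block_matrix \<phi> M ** Y"
  shows "Y = comm_block (\<lambda>i k k'. Y $ \<psi> (i, 0, k) $ \<psi> (i, 0, k'))"
proof (rule matrix_eqI)
  fix i j k i' j' k'
  assume A: "i \<in> K" "j < d i" "k < m i" "i' \<in> K" "j' < d i'" "k' < m i'"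
  have off: "Y $ \<psi> (i, j, k) $ \<psi> (i', j', k') = 0" if "i \<noteq> i' \<or> j \<noteq> j'"
  proof -
    have "Y $ \<psi> (i, j, k) $ \<psi> (i', j', k')
        = (Y ** block_matrix \<phi> (matrix_unit i' j' j')) $ \<psi> (i, j, k) $ \<psi> (i', j', k')"
      unfolding block_matrix_mult_nth(2)[OF A] using A
      by (simp add: matrix_unit_def if_distrib[of "\<lambda>x. _ * x"] cong: if_cong)
    also have "\<dots> = 0"
      unfolding comm block_matrix_mult_nth(1)[OF A] using that
      by (auto simp: matrix_unit_def intro!: sum.neutral)
    finally show ?thesis .
  qed
  have diag: "Y $ \<psi> (i, j, k) $ \<psi> (i, j, k') = Y $ \<psi> (i, 0, k) $ \<psi> (i, 0, k')"
    if "k' < m i"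
  proof -
    have A': "i \<in> K" "j < d i" "k < m i" "i \<in> K" "0 < d i" "k' < m i" using A that by auto
    have "Y $ \<psi> (i, j, k) $ \<psi> (i, j, k')
        = (Y ** block_matrix \<phi> (matrix_unit i j 0)) $ \<psi> (i, j, k) $ \<psi> (i, 0, k')"
      unfolding block_matrix_mult_nth(2)[OF A'] using A
      by (simp add: matrix_unit_def if_distrib[of "\<lambda>x. _ * x"] cong: if_cong)
    also have "\<dots> = Y $ \<psi> (i, 0, k) $ \<psi> (i, 0, k')"
      unfolding comm block_matrix_mult_nth(1)[OF A'] using A'
      by (simp add: matrix_unit_def if_distrib[of "\<lambda>x. x * _"] cong: if_cong)
    finally show ?thesis .
  qed
  show "Y $ \<psi> (i, j, k) $ \<psi> (i', j', k') =
      comm_block (\<lambda>i k k'. Y $ \<psi> (i, 0, k) $ \<psi> (i, 0, k')) $ \<psi> (i, j, k) $ \<psi> (i', j', k')"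
    using A off diag by (auto simp: comm_block_nth)
qed

lemma centralizer_range_block_op: "centralizer (range block_op) = range (\<lambda>N. conj_by U (comm_block N))"
proof (intro set_eqI iffI)
  fix X assume X: "X \<in> centralizer (range block_op)"
  define Y where "Y = conj_by (adj U) X"
  have XY: "X = conj_by U Y" by (simp add: Y_def conj_by_inverse unitary)
  have "Y ** block_matrix \<phi> M = block_matrix \<phi> M ** Y" for M
  proof -
    have "X ** block_op M = block_op M ** X" using X by (simp add: centralizer_def)
    then show ?thesis by (simp add: XY block_op_def conj_by_mult conj_by_inject unitary)
  qed
  then show "X \<in> range (\<lambda>N. conj_by U (comm_block N))"
    unfolding XY by (intro range_eqI) (rule arg_cong[where f = "conj_by U"], rule commuting_imp_comm_block)
next
  fix X assume "X \<in> range (\<lambda>N. conj_by U (comm_block N))"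
  then show "X \<in> centralizer (range block_op)"
    by (auto simp: centralizer_def block_op_def conj_by_mult unitary comm_block_commutes)
qed

lemma dim_centralizer: "cmat.dim (centralizer (range block_op)) = (\<Sum>i\<in>K. (m i)\<^sup>2)"
proof -
  \<comment> \<open>Dually to the algebra itself, the label now forgets j; the representative j = 0
    exists because d i is positive.\<close>
  define g where "g r c = (case (\<phi> r, \<phi> c) of ((i, j, k), (i', j', k')) \<Rightarrow>
    if i = i' \<and> j = j' then Some (i, k, k') else None)" for r c
  let ?X = "SIGMA i:K. {..<m i} \<times> {..<m i}"
  have eq: "pattern g f = comm_block (\<lambda>i k k'. f (i, k, k'))" for f
    by (auto simp: comm_block_def pattern_def g_def vec_eq_iff split: prod.split)
  have "conj_by U (comm_block N) \<in> {conj_by U (pattern g f) | f. True}" for N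
    by (rule CollectI, rule exI[of _ "\<lambda>(i, k, k'). N i k k'"]) (simp add: eq)
  then have "centralizer (range block_op) = {conj_by U (pattern g f) | f. True}"
    unfolding centralizer_range_block_op by (auto simp: eq)
  moreover have "?X = {x. \<exists>r c. g r c = Some x}"
  proof (intro set_eqI iffI)
    fix x assume "x \<in> ?X"
    then obtain i k k' where x: "x = (i, k, k')" "i \<in> K" "k < m i" "k' < m i" by auto
    then have "g (\<psi> (i, 0, k)) (\<psi> (i, 0, k')) = Some x" using pos[of i] by (simp add: g_def)
    then show "x \<in> {x. \<exists>r c. g r c = Some x}" by blast
  next
    fix x assume "x \<in> {x. \<exists>r c. g r c = Some x}"
    then obtain r c where "g r c = Some x" by blast
    then show "x \<in> ?X"
      by (cases r rule: label_cases; cases c rule: label_cases) (auto simp: g_def split: if_splits)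
  qed
  ultimately have "cmat.dim (centralizer (range block_op)) = card ?X" by (simp only: dim_pattern[OF unitary refl])
  also have "\<dots> = (\<Sum>i\<in>K. (m i)\<^sup>2)"
    using finite_K by (subst card_SigmaI) (auto simp: card_cartesian_product power2_eq_square)
  finally show ?thesis .
qed

text \<open>A matrix that has both forms M i \<otimes> 1 and 1 \<otimes> N i is a scalar on each
  component, so the component alone serves as label.\<close>

lemma dim_center: "cmat.dim (center (range block_op)) = card K"
proof -
  define g where "g r c = (if r = c then Some (fst (\<phi> r)) else None)" for r c
  have nth: "pattern g f $ \<psi> (i, j, k) $ \<psi> (i', j', k')
      = (if i = i' \<and> j = j' \<and> k = k' then f i else 0)"
    if "i \<in> K" "j < d i" "k < m i" "i' \<in> K" "j' < d i'" "k' < m i'" for f i j k i' j' k'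
  proof -
    have "\<psi> (i, j, k) = \<psi> (i', j', k') \<longleftrightarrow> (i, j, k) = (i', j', k')"
      using that by (metis \<phi>_\<psi>)
    then show ?thesis using that by (auto simp: pattern_def g_def)
  qed
  have "center (range block_op) = {conj_by U (pattern g f) | f. True}"
  proof (intro set_eqI iffI)
    fix X assume "X \<in> center (range block_op)"
    then have "X \<in> range block_op" "X \<in> range (\<lambda>N. conj_by U (comm_block N))"
      unfolding center_def centralizer_range_block_op by simp_all
    then obtain M N where M: "X = conj_by U (block_matrix \<phi> M)" and N: "X = conj_by U (comm_block N)"
      unfolding block_op_def by blast
    then have MN: "block_matrix \<phi> M = comm_block N" using conj_by_inject[OF unitary] by simp
    have "block_matrix \<phi> M = pattern g (\<lambda>i. N i 0 0)"
    proof (rule matrix_eqI)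
      fix i j k i' j' k'
      assume A: "i \<in> K" "j < d i" "k < m i" "i' \<in> K" "j' < d i'" "k' < m i'"
      have eq: "block_matrix \<phi> M $ r $ c = comm_block N $ r $ c" for r c by (simp add: MN)
      \<comment> \<open>Comparing diagonal entries at (i, j, 0) and at (i, j, k) shows that the
        value depends neither on j nor on k.\<close>
      have "M i j j = N i 0 0" "M i j j = N i k k"
        using eq[of "\<psi> (i, j, 0)" "\<psi> (i, j, 0)"] eq[of "\<psi> (i, j, k)" "\<psi> (i, j, k)"] A pos[of i]
        by (auto simp: block_matrix_nth comm_block_nth)
      then show "block_matrix \<phi> M $ \<psi> (i, j, k) $ \<psi> (i', j', k')
          = pattern g (\<lambda>i. N i 0 0) $ \<psi> (i, j, k) $ \<psi> (i', j', k')"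
        using A eq[of "\<psi> (i, j, k)" "\<psi> (i', j', k')"]
        by (auto simp: nth block_matrix_nth comm_block_nth split: if_splits)
    qed
    then show "X \<in> {conj_by U (pattern g f) | f. True}" using M by auto
  next
    fix X assume "X \<in> {conj_by U (pattern g f) | f. True}"
    then obtain f where X: "X = conj_by U (pattern g f)" by blast
    have "pattern g f = block_matrix \<phi> (\<lambda>i j j'. if j = j' then f i else 0)"
      by (rule matrix_eqI) (auto simp: nth block_matrix_nth)
    moreover have "pattern g f = comm_block (\<lambda>i k k'. if k = k' then f i else 0)"
      by (rule matrix_eqI) (auto simp: nth comm_block_nth)
    ultimately have "X \<in> range block_op" "X \<in> range (\<lambda>N. conj_by U (comm_block N))"
      unfolding X block_op_def by (metis rangeI)+
    then show "X \<in> center (range block_op)"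
      unfolding center_def centralizer_range_block_op by simp
  qed
  moreover have "K = {x. \<exists>r c. g r c = Some x}"
  proof (intro set_eqI iffI)
    fix i assume "i \<in> K"
    then have "g (\<psi> (i, 0, 0)) (\<psi> (i, 0, 0)) = Some i" using pos[of i] by (simp add: g_def)
    then show "i \<in> {x. \<exists>r c. g r c = Some x}" by blast
  next
    fix i assume "i \<in> {x. \<exists>r c. g r c = Some x}"
    then obtain r c where "g r c = Some i" by blast
    then show "i \<in> K"
      by (cases r rule: label_cases) (auto simp: g_def split: if_splits)
  qed
  ultimately show ?thesis by (simp only: dim_pattern[OF unitary refl])
qed

section \<open>A criterion for generating the whole block algebra\<close>

definition diag :: "('i \<Rightarrow> nat \<Rightarrow> complex) \<Rightarrow> complex ^ 'm ^ 'm" where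
  "diag f = block_op (\<lambda>i j j'. if j = j' then f i j else 0)"

lemma diag_add: "diag f + diag g = diag (\<lambda>i j. f i j + g i j)"
  unfolding diag_def block_op_add by (rule block_op_cong) simp

lemma diag_cscale: "cscale c (diag f) = diag (\<lambda>i j. c * f i j)"
  unfolding diag_def block_op_cscale by (rule block_op_cong) simp

lemma diag_mult: "diag f ** diag g = diag (\<lambda>i j. f i j * g i j)"
  unfolding diag_def block_op_mult
  by (rule block_op_cong) (simp add: if_distrib[of "\<lambda>x. x * _"] if_distrib[of "\<lambda>x. _ * x"] cong: if_cong)

lemma block_op_sum: "(\<Sum>x\<in>X. block_op (F x)) = block_op (\<lambda>i j j'. \<Sum>x\<in>X. F x i j j')"
proof (induction X rule: infinite_finite_induct)
  case (insert x X)
  then show ?case by (simp add: block_op_add)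
qed (simp_all add: block_op_def block_matrix_def zero_vec_def case_prod_beta' flip: zero_vec_def)

lemma block_op_expand:
  "block_op M = (\<Sum>(i, a, b)\<in>(SIGMA i:K. {..<d i} \<times> {..<d i}). cscale (M i a b) (block_op (matrix_unit i a b)))"
proof -
  let ?X = "SIGMA i:K. {..<d i} \<times> {..<d i}"
  have "(\<Sum>(i, a, b)\<in>?X. cscale (M i a b) (block_op (matrix_unit i a b)))
      = block_op (\<lambda>i j j'. \<Sum>x\<in>?X. (case x of (i, a, b) \<Rightarrow> \<lambda>i' j j'. M i a b * matrix_unit i a b i' j j') i j j')"
    unfolding block_op_sum[symmetric] by (intro sum.cong refl) (auto simp: block_op_cscale)
  also have "\<dots> = block_op M"
  proof (rule block_op_cong)
    fix i j j' assume ij: "i \<in> K" "j < d i" "j' < d i"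
    have "(\<Sum>x\<in>?X. (case x of (i, a, b) \<Rightarrow> \<lambda>i' j j'. M i a b * matrix_unit i a b i' j j') i j j')
        = (\<Sum>x\<in>?X. if x = (i, j, j') then M i j j' else 0)"
      by (intro sum.cong refl) (auto simp: matrix_unit_def split: if_splits)
    also have "\<dots> = M i j j'"
      using ij finite_K by (subst sum.delta) auto
    finally show "(\<Sum>x\<in>?X. (case x of (i, a, b) \<Rightarrow> \<lambda>i' j j'. M i a b * matrix_unit i a b i' j j') i j j')
      = M i j j'" .
  qed
  finally show ?thesis by simp
qed

lemma matrix_unit_sandwich:
  assumes "a < d i" "b < d i"
  shows "block_op (matrix_unit i a a) ** block_op M ** block_op (matrix_unit i b b) = cscale (M i a b) (block_op (matrix_unit i a b))"
  unfolding block_op_mult block_op_cscale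
proof (rule block_op_cong)
  fix i' j j' assume "i' \<in> K" "j < d i'" "j' < d i'"
  have "(\<Sum>l'<d i'. matrix_unit i a a i' j l' * M i' l' l) = (if i' = i \<and> j = a then M i a l else 0)" for l
    using assms by (auto simp: matrix_unit_def if_distrib[of "\<lambda>x. x * _"] cong: if_cong)
  then show "(\<Sum>l<d i'. (\<Sum>l'<d i'. matrix_unit i a a i' j l' * M i' l' l) * matrix_unit i b b i' l j')
      = M i a b * matrix_unit i a b i' j j'"
    using assms by (auto simp: matrix_unit_def if_distrib[of "\<lambda>x. _ * x"] cong: if_cong)
qed

lemma matrix_unit_mult:
  assumes "b < d i"
  shows "block_op (matrix_unit i a b) ** block_op (matrix_unit i b c) = block_op (matrix_unit i a c)"
  unfolding block_op_mult
  by (rule block_op_cong)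
    (use assms in \<open>auto simp: matrix_unit_def if_distrib[of "\<lambda>x. x * _"] if_distrib[of "\<lambda>x. _ * x"] cong: if_cong\<close>)

text \<open>Diagonal elements that separate the pairs (i, j) yield the diagonal matrix units by
  interpolation. Cutting \<open>block_op R\<close> and \<open>block_op L\<close> with these gives
  the units between neighbouring indices, and products of neighbours give all units.\<close>

lemma range_block_op_subset:
  assumes alg: "unital_subalgebra A"
    and sep: "\<And>i j i' j'. \<lbrakk>i \<in> K; j < d i; i' \<in> K; j' < d i'; (i, j) \<noteq> (i', j')\<rbrakk>
      \<Longrightarrow> \<exists>f. diag f \<in> A \<and> f i j \<noteq> f i' j'"
    and up: "block_op R \<in> A" "\<And>i j. \<lbrakk>i \<in> K; Suc j < d i\<rbrakk> \<Longrightarrow> R i (Suc j) j \<noteq> 0"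
    and down: "block_op L \<in> A" "\<And>i j. \<lbrakk>i \<in> K; Suc j < d i\<rbrakk> \<Longrightarrow> L i j (Suc j) \<noteq> 0"
  shows "range block_op \<subseteq> A"
proof -
  have one: "mat 1 \<in> A" and add: "\<And>X Y. X \<in> A \<Longrightarrow> Y \<in> A \<Longrightarrow> X + Y \<in> A"
    and scale: "\<And>c X. X \<in> A \<Longrightarrow> cscale c X \<in> A"
    and mult: "\<And>X Y. X \<in> A \<Longrightarrow> Y \<in> A \<Longrightarrow> X ** Y \<in> A"
    using alg by (auto simp: unital_subalgebra_def)
  have one': "diag (\<lambda>_ _. 1) \<in> A"
    using one by (simp add: mat_1_eq_block_op diag_def)
  let ?I = "SIGMA i:K. {..<d i}"
  \<comment> \<open>An affine rescaling of the separating function, possible because the identity is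
    in A.\<close>
  have pair: "\<exists>f. diag f \<in> A \<and> f i j = 1 \<and> f i' j' = 0"
    if ij: "(i, j) \<in> ?I" "(i', j') \<in> ?I" "(i, j) \<noteq> (i', j')" for i j i' j'
  proof -
    obtain f where f: "diag f \<in> A" "f i j \<noteq> f i' j'" using sep[of i j i' j'] ij by auto
    let ?c = "1 / (f i j - f i' j')"
    have "cscale ?c (diag f) + cscale (- ?c * f i' j') (diag (\<lambda>_ _. 1)) \<in> A"
      by (intro add scale f one')
    then have "diag (\<lambda>a b. ?c * f a b + (- ?c * f i' j') * 1) \<in> A"
      unfolding diag_cscale diag_add .
    then show ?thesis
      using f(2) by (intro exI[of _ "\<lambda>a b. ?c * f a b + (- ?c * f i' j') * 1"])
        (simp add: divide_simps)
  qed
  \<comment> \<open>Lagrange interpolation: multiply the two-point functions over all points of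
    Q.\<close>
  have sep_set: "\<exists>f. diag f \<in> A \<and> f i j = 1 \<and> (\<forall>(a, b)\<in>Q. f a b = 0)"
    if "finite Q" "Q \<subseteq> ?I - {(i, j)}" "(i, j) \<in> ?I" for Q i j
    using that
  proof (induction Q rule: finite_induct)
    case empty
    then show ?case using one' by auto
  next
    case (insert q Q)
    obtain i' j' where q: "q = (i', j')" by (cases q)
    obtain f where f: "diag f \<in> A" "f i j = 1" "\<forall>(a, b)\<in>Q. f a b = 0"
      using insert by auto
    obtain g where g: "diag g \<in> A" "g i j = 1" "g i' j' = 0"
      using pair[of i j i' j'] insert.prems q by auto
    have "diag (\<lambda>a b. f a b * g a b) \<in> A"
      unfolding diag_mult[symmetric] by (intro mult f g)
    then show ?case using f g q by (intro exI[of _ "\<lambda>a b. f a b * g a b"]) auto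
  qed
  have idem: "block_op (matrix_unit i j j) \<in> A" if ij: "i \<in> K" "j < d i" for i j
  proof -
    obtain f where f: "diag f \<in> A" "f i j = 1" "\<forall>(a, b)\<in>?I - {(i, j)}. f a b = 0"
      using sep_set[of "?I - {(i, j)}" i j] ij finite_K by auto
    have "diag f = block_op (matrix_unit i j j)"
      unfolding diag_def by (rule block_op_cong) (use f in \<open>auto simp: matrix_unit_def\<close>)
    then show ?thesis using f by simp
  qed
  \<comment> \<open>Multiplying by diagonal units on both sides isolates one entry of M, which is
    then divided out.\<close>
  have entry: "block_op (matrix_unit i a b) \<in> A" if "block_op M \<in> A" "M i a b \<noteq> 0" "i \<in> K" "a < d i" "b < d i" for M i a b
  proof -
    have "cscale (1 / M i a b) (block_op (matrix_unit i a a) ** block_op M ** block_op (matrix_unit i b b)) \<in> A"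
      using that by (intro scale mult idem)
    moreover have "cscale (1 / M i a b) (cscale (M i a b) (block_op (matrix_unit i a b))) = block_op (matrix_unit i a b)"
      using that by (simp add: vec_eq_iff)
    ultimately show ?thesis using that by (simp add: matrix_unit_sandwich)
  qed
  \<comment> \<open>The induction runs over the distance t between row and column, with one
    neighbouring unit added at each step.\<close>
  have shift: "block_op (matrix_unit i (b + t) b) \<in> A \<and> block_op (matrix_unit i b (b + t)) \<in> A" if "i \<in> K" "b + t < d i" for i b t
    using that
  proof (induction t)
    case (Suc t)
    have "block_op (matrix_unit i (Suc (b + t)) (b + t)) \<in> A" "block_op (matrix_unit i (b + t) (Suc (b + t))) \<in> A"
      using Suc.prems by (auto intro: entry[OF up(1)] entry[OF down(1)] simp: up(2) down(2))
    then have "block_op (matrix_unit i (Suc (b + t)) (b + t)) ** block_op (matrix_unit i (b + t) b) \<in> A"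
      "block_op (matrix_unit i b (b + t)) ** block_op (matrix_unit i (b + t) (Suc (b + t))) \<in> A"
      using Suc by (auto intro: mult)
    then show ?case using Suc.prems by (simp add: matrix_unit_mult)
  qed (simp add: idem)
  have units: "block_op (matrix_unit i a b) \<in> A" if "i \<in> K" "a < d i" "b < d i" for i a b
    using shift[of i b "a - b"] shift[of i a "b - a"] that by (cases "a \<le> b") auto
  have zero: "0 \<in> A"
  proof -
    have "cscale 0 (mat 1) = (0 :: complex ^ 'm ^ 'm)" by (simp add: vec_eq_iff)
    then show ?thesis using scale[OF one, of 0] by simp
  qed
  have sum_in: "(\<Sum>x\<in>X. F x) \<in> A" if "\<And>x. x \<in> X \<Longrightarrow> F x \<in> A" for X and F :: "'x \<Rightarrow> _"
    using that by (induction X rule: infinite_finite_induct) (simp_all add: zero add)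
  have "block_op M \<in> A" for M
    by (subst block_op_expand) (auto intro!: sum_in scale units)
  then show ?thesis by blast
qed

end

text \<open>The matrix with columns u is square by the cardinality assumption, so the orthonormality
  of its columns already makes it unitary. The coordinate formula turns the search for block
  matrices into the computation of inner products.\<close>

lemma orthonormal_frame:
  fixes u :: "'i \<times> nat \<times> nat \<Rightarrow> complex ^ 'm::finite"
  assumes card: "card (block_index K d m) = CARD('m)"
    and orth: "\<And>x y. \<lbrakk>x \<in> block_index K d m; y \<in> block_index K d m\<rbrakk>
      \<Longrightarrow> cinner (u x) (u y) = (if x = y then 1 else 0)"
  obtains \<phi> :: "'m \<Rightarrow> 'i \<times> nat \<times> nat" and U where "bij_betw \<phi> UNIV (block_index K d m)" "unitary U"
    "\<And>X r c. conj_by (adj U) X $ r $ c = cinner (X *v u (\<phi> c)) (u (\<phi> r))"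
proof -
  have "finite (block_index K d m)" using card by (metis card.infinite finite UNIV_not_empty card_eq_0_iff)
  then obtain \<phi> :: "'m \<Rightarrow> 'i \<times> nat \<times> nat" where \<phi>: "bij_betw \<phi> UNIV (block_index K d m)"
    using finite_same_card_bij[of "UNIV :: 'm set" "block_index K d m"] card by auto
  define U :: "complex ^ 'm ^ 'm" where "U = (\<chi> r c. u (\<phi> c) $ r)"
  have conj: "conj_by (adj U) X $ r $ c = cinner (X *v u (\<phi> c)) (u (\<phi> r))" for X r c
  proof -
    have "adj U ** (X ** U) = conj_by (adj U) X" by (simp add: conj_by_def matrix_mul_assoc)
    moreover have "(adj U ** (X ** U)) $ r $ c = cinner (X *v u (\<phi> c)) (u (\<phi> r))"
      by (simp add: matrix_matrix_mult_def matrix_vector_mult_def cinner_def U_def mult.commute)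
    ultimately show ?thesis by simp
  qed
  have in_index: "\<phi> r \<in> block_index K d m" for r using bij_betwE[OF \<phi>] by simp
  have mat_nth: "(mat 1 :: complex ^ 'm ^ 'm) $ r $ c = (if r = c then 1 else 0)" for r c
    by (simp add: mat_def)
  \<comment> \<open>Conjugating the identity produces the Gram matrix of the family.\<close>
  have "conj_by (adj U) (mat 1) = mat 1"
    using bij_betw_imp_inj_on[OF \<phi>]
    by (auto simp: vec_eq_iff conj orth[OF in_index in_index] mat_nth inj_def)
  then have "adj U ** U = mat 1" by (simp add: conj_by_def)
  then have "unitary U" by (simp add: unitary_def matrix_left_right_inverse)
  with \<phi> conj show thesis using that by blast
qed

section \<open>Raising and lowering operators on the Boolean lattice\<close>

lemma T_op_nth: "(T_op *v v) $ I = (\<Sum>i\<in>I. v $ (I - {i}))" for v :: "complex ^ ('n::finite set)"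
proof -
  have "(T_op *v v) $ I = (\<Sum>J\<in>UNIV. \<Sum>i\<in>UNIV. (if i \<notin> J \<and> I = insert i J then v $ J else 0))"
    by (auto simp: matrix_vector_mult_def T_op_def e_op_def sum_distrib_right intro!: sum.cong)
  also have "\<dots> = (\<Sum>i\<in>UNIV. \<Sum>J\<in>UNIV. (if i \<notin> J \<and> I = insert i J then v $ J else 0))"
    by (rule sum.swap)
  also have "\<dots> = (\<Sum>i\<in>UNIV. \<Sum>J\<in>UNIV. (if J = I - {i} then if i \<in> I then v $ (I - {i}) else 0 else 0))"
  proof (intro sum.cong refl)
    fix i J
    have "i \<notin> J \<and> I = insert i J \<longleftrightarrow> J = I - {i} \<and> i \<in> I" by auto
    then show "(if i \<notin> J \<and> I = insert i J then v $ J else 0)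
        = (if J = I - {i} then if i \<in> I then v $ (I - {i}) else 0 else 0)" by simp
  qed
  also have "\<dots> = (\<Sum>i\<in>I. v $ (I - {i}))"
    by (simp add: sum.If_cases)
  finally show ?thesis .
qed

lemma Tstar_op_eq_adj: "Tstar_op = adj T_op"
  by (simp add: Tstar_op_def T_op_def \<delta>_op_def adj_sum)

lemma Tstar_op_nth: "(Tstar_op *v v) $ I = (\<Sum>i\<in>-I. v $ (insert i I))" for v :: "complex ^ ('n::finite set)"
proof -
  have "(Tstar_op *v v) $ I = (\<Sum>J\<in>UNIV. \<Sum>i\<in>UNIV. (if i \<notin> I \<and> J = insert i I then v $ J else 0))"
    by (auto simp: matrix_vector_mult_def Tstar_op_def \<delta>_op_def e_op_def sum_distrib_right intro!: sum.cong)
  also have "\<dots> = (\<Sum>i\<in>UNIV. \<Sum>J\<in>UNIV. (if i \<notin> I \<and> J = insert i I then v $ J else 0))"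
    by (rule sum.swap)
  also have "\<dots> = (\<Sum>i\<in>UNIV. \<Sum>J\<in>UNIV. (if J = insert i I then if i \<notin> I then v $ (insert i I) else 0 else 0))"
    by (intro sum.cong refl) auto
  also have "\<dots> = (\<Sum>i\<in>-I. v $ (insert i I))"
    by (simp add: sum.If_cases Compl_eq)
  finally show ?thesis .
qed

text \<open>Both compositions contain the same double sum over the ways to exchange an element j of
  I for an element i outside. What remains are the moves that return to I: one for each element of
  the complement in the first order, one for each element of I in the second.\<close>

lemma Tstar_T_commutator:
  fixes v :: "complex ^ ('n::finite set)"
  shows "(Tstar_op *v (T_op *v v)) $ I
    = (T_op *v (Tstar_op *v v)) $ I + (of_nat CARD('n) - 2 * of_nat (card I)) * v $ I"
proof -
  let ?S = "\<Sum>i\<in>-I. \<Sum>j\<in>I. v $ (insert i (I - {j}))"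
  have "(\<Sum>j\<in>insert i I. v $ (insert i I - {j})) = v $ I + (\<Sum>j\<in>I. v $ (insert i (I - {j})))"
    if "i \<in> -I" for i
  proof -
    have "(\<Sum>j\<in>insert i I. v $ (insert i I - {j})) = v $ (insert i I - {i}) + (\<Sum>j\<in>I. v $ (insert i I - {j}))"
      using that by (intro sum.insert) auto
    moreover have "insert i I - {i} = I" "\<And>j. j \<in> I \<Longrightarrow> insert i I - {j} = insert i (I - {j})"
      using that by auto
    ultimately show ?thesis by simp
  qed
  then have 1: "(Tstar_op *v (T_op *v v)) $ I = of_nat (card (-I)) * v $ I + ?S"
    by (simp add: Tstar_op_nth T_op_nth sum.distrib)
  have "(\<Sum>i\<in>-(I - {j}). v $ (insert i (I - {j}))) = v $ I + (\<Sum>i\<in>-I. v $ (insert i (I - {j})))"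
    if "j \<in> I" for j
  proof -
    have "- (I - {j}) = insert j (- I)" "insert j (I - {j}) = I" using that by auto
    then show ?thesis using that by simp
  qed
  then have "(T_op *v (Tstar_op *v v)) $ I = of_nat (card I) * v $ I + (\<Sum>j\<in>I. \<Sum>i\<in>-I. v $ (insert i (I - {j})))"
    by (simp add: Tstar_op_nth T_op_nth sum.distrib)
  also have "(\<Sum>j\<in>I. \<Sum>i\<in>-I. v $ (insert i (I - {j}))) = ?S" by (rule sum.swap)
  finally have 2: "(T_op *v (Tstar_op *v v)) $ I = of_nat (card I) * v $ I + ?S" .
  have "card (-I) + card I = CARD('n)"
    by (metis card_Un_disjoint Compl_disjoint2 Un_commute Compl_partition finite)
  then have compl: "of_nat (card (-I)) = (of_nat CARD('n) - of_nat (card I) :: complex)"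
    by (metis add_diff_cancel_right' of_nat_add)
  show ?thesis unfolding 1 2 compl by (simp add: algebra_simps)
qed

section \<open>Levels, primitive vectors and the inner product\<close>

definition level :: "nat \<Rightarrow> (complex ^ ('n::finite set)) set" where
  "level r = {v. \<forall>I. card I \<noteq> r \<longrightarrow> v $ I = 0}"

text \<open>These are the lowest weight vectors when \<open>T_op\<close> is taken as raising and
  \<open>Tstar_op\<close> as lowering operator.\<close>

definition primitive :: "nat \<Rightarrow> (complex ^ ('n::finite set)) set" where
  "primitive r = {v \<in> level r. Tstar_op *v v = 0}"

lemma T_op_level: "v \<in> level r \<Longrightarrow> T_op *v v \<in> level (Suc r)"
  unfolding level_def mem_Collect_eq T_op_nth
  by (auto intro!: sum.neutral simp: card_Diff_singleton_if card_gt_0_iff)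
    (metis card_Suc_Diff1 finite)

lemma level_scale: "v \<in> level r \<Longrightarrow> c *s v \<in> level r"
  by (simp add: level_def)

lemma cinner_level_neq: "v \<in> level r \<Longrightarrow> w \<in> level s \<Longrightarrow> r \<noteq> s \<Longrightarrow> cinner v w = 0"
  unfolding level_def cinner_def mem_Collect_eq
  by (intro sum.neutral ballI) (metis complex_cnj_zero mult_zero_left mult_zero_right)

lemma cinner_scale_left: "cinner (c *s v) w = c * cinner v w"
  by (simp add: cinner_def sum_distrib_left mult_ac)

lemma cinner_scale_right: "cinner v (c *s w) = cnj c * cinner v w"
  by (simp add: cinner_def sum_distrib_left mult_ac)

lemma cinner_commute: "cinner v w = cnj (cinner w v)"
  by (simp add: cinner_def mult.commute)

lemma cinner_0_left [simp]: "cinner 0 w = 0"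
  by (simp add: cinner_def)

lemma cinner_self: "cinner v v = of_real (\<Sum>i\<in>UNIV. (norm (v $ i))\<^sup>2)"
  by (simp add: cinner_def complex_norm_square del: of_real_power)

lemma cinner_self_eq_0: "cinner v v = 0 \<longleftrightarrow> v = 0"
  by (simp add: cinner_self sum_nonneg_eq_0_iff vec_eq_iff del: of_real_sum)

lemma cinner_T_op: "cinner (T_op *v v) w = cinner v (Tstar_op *v w)"
  by (simp add: cinner_adj Tstar_op_eq_adj)

text \<open>On an irreducible component of highest weight \<open>n - 2 * \<alpha>\<close>, \<open>ladder\<close> is the matrix
  coefficient of \<open>T\<close> between consecutive vectors of the orthonormal weight basis.\<close>

definition ladder :: "nat \<Rightarrow> nat \<Rightarrow> nat \<Rightarrow> real" where
  "ladder n \<alpha> j = sqrt (real (Suc j) * (real n - 2 * real \<alpha> - real j))"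

lemma ladder_pos: "j + 2 * \<alpha> < n \<Longrightarrow> ladder n \<alpha> j > 0"
  by (simp add: ladder_def)

lemma ladder_square: "j + 2 * \<alpha> \<le> n \<Longrightarrow> (ladder n \<alpha> j)\<^sup>2 = real (Suc j) * (real n - 2 * real \<alpha> - real j)"
  by (simp add: ladder_def)

section \<open>Orthonormal chains above primitive vectors\<close>

primrec chain :: "nat \<Rightarrow> complex ^ ('n::finite set) \<Rightarrow> nat \<Rightarrow> complex ^ ('n set)" where
  "chain \<alpha> v 0 = v"
| "chain \<alpha> v (Suc j) = (1 / complex_of_real (ladder CARD('n) \<alpha> j)) *s (T_op *v chain \<alpha> v j)"

lemma chain_level: "v \<in> level \<alpha> \<Longrightarrow> chain \<alpha> v j \<in> level (\<alpha> + j)"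
  by (induction j) (simp_all add: level_scale T_op_level)

lemma T_chain:
  fixes v :: "complex ^ ('n::finite set)"
  assumes "j + 2 * \<alpha> < CARD('n)"
  shows "T_op *v chain \<alpha> v j = complex_of_real (ladder CARD('n) \<alpha> j) *s chain \<alpha> v (Suc j)"
  using ladder_pos[OF assms] by (simp add: vec_eq_iff)

text \<open>On a level the commutator is a scalar. It gives the whole value at the primitive vector,
  which \<open>Tstar_op\<close> kills, and afterwards the increment from one squared ladder
  coefficient to the next. The top of the chain is included, where the coefficient is 0.\<close>

lemma Tstar_T_chain:
  fixes v :: "complex ^ ('n::finite set)"
  assumes v: "v \<in> primitive \<alpha>" and "j + 2 * \<alpha> \<le> CARD('n)"
  shows "Tstar_op *v (T_op *v chain \<alpha> v j) = complex_of_real ((ladder CARD('n) \<alpha> j)\<^sup>2) *s chain \<alpha> v j"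
  using assms(2)
proof (induction j)
  case 0
  \<comment> \<open>Coordinates off the level vanish, so the size of I may be replaced by \<alpha>
    in the commutator.\<close>
  have "card I = \<alpha> \<or> v $ I = 0" for I using v by (auto simp: primitive_def level_def)
  then have weight: "(of_nat CARD('n) - 2 * of_nat (card I)) * v $ I
      = (of_nat CARD('n) - 2 * of_nat \<alpha>) * v $ I" for I by (metis mult_zero_right)
  have "(Tstar_op *v (T_op *v v)) $ I = (of_nat CARD('n) - 2 * of_nat \<alpha>) * v $ I" for I
    unfolding Tstar_T_commutator weight using v by (simp add: primitive_def)
  then show ?case
    using 0 by (simp add: vec_eq_iff ladder_square left_diff_distrib)
next
  case (Suc j)
  let ?t = "ladder CARD('n) \<alpha>"
  have pos: "?t j > 0" using Suc.prems by (intro ladder_pos) simp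
  have "Tstar_op *v chain \<alpha> v (Suc j) = (1 / complex_of_real (?t j)) *s (Tstar_op *v (T_op *v chain \<alpha> v j))"
    by (simp add: matrix_vector_mult_scaleR vec.scale)
  also have "\<dots> = complex_of_real (?t j) *s chain \<alpha> v j"
    using pos Suc by (simp add: vec_eq_iff power2_eq_square)
  finally have "T_op *v (Tstar_op *v chain \<alpha> v (Suc j)) = complex_of_real (?t j) *s (T_op *v chain \<alpha> v j)"
    by (simp add: vec.scale del: chain.simps)
  also have "\<dots> = complex_of_real ((?t j)\<^sup>2) *s chain \<alpha> v (Suc j)"
    using Suc.prems by (subst T_chain) (simp_all add: power2_eq_square del: chain.simps)
  finally have TT: "T_op *v (Tstar_op *v chain \<alpha> v (Suc j)) = complex_of_real ((?t j)\<^sup>2) *s chain \<alpha> v (Suc j)" .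
  have "chain \<alpha> v (Suc j) \<in> level (\<alpha> + Suc j)"
    using v unfolding primitive_def by (intro chain_level) simp
  then have "card I = \<alpha> + Suc j \<or> chain \<alpha> v (Suc j) $ I = 0" for I
    by (auto simp: level_def)
  then have weight: "(of_nat CARD('n) - 2 * of_nat (card I)) * chain \<alpha> v (Suc j) $ I
      = (of_nat CARD('n) - 2 * of_nat (\<alpha> + Suc j)) * chain \<alpha> v (Suc j) $ I" for I
    by (metis mult_zero_right)
  \<comment> \<open>The squared coefficients grow exactly by the weight of level \<alpha> + j + 1;
    the square root in \<open>ladder\<close> was chosen to make this so.\<close>
  have "(?t (Suc j))\<^sup>2 = (?t j)\<^sup>2 + (real CARD('n) - 2 * real (\<alpha> + Suc j))"
    using Suc.prems by (simp add: ladder_square algebra_simps)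
  then have "complex_of_real ((?t (Suc j))\<^sup>2) = complex_of_real ((?t j)\<^sup>2) + (of_nat CARD('n) - 2 * of_nat (\<alpha> + Suc j))"
    by simp
  then show ?case
    unfolding vec_eq_iff Tstar_T_commutator TT weight
    by (simp only: vector_smult_component distrib_right simp_thms)
qed

lemma Tstar_chain:
  fixes v :: "complex ^ ('n::finite set)"
  assumes v: "v \<in> primitive \<alpha>" and j: "j + 2 * \<alpha> < CARD('n)"
  shows "Tstar_op *v chain \<alpha> v (Suc j) = complex_of_real (ladder CARD('n) \<alpha> j) *s chain \<alpha> v j"
  using Tstar_T_chain[OF v, of j] ladder_pos[OF j] j
  by (simp add: vec.scale vec_eq_iff power2_eq_square)

text \<open>The ladder coefficient is 0 at the top, and by adjointness so is the squared norm of the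
  raised vector.\<close>

lemma T_chain_top:
  fixes v :: "complex ^ ('n::finite set)"
  assumes v: "v \<in> primitive \<alpha>" and j: "j + 2 * \<alpha> = CARD('n)"
  shows "T_op *v chain \<alpha> v j = 0"
proof -
  have "ladder CARD('n) \<alpha> j = 0"
    unfolding ladder_def by (simp flip: j)
  then have "Tstar_op *v (T_op *v chain \<alpha> v j) = 0"
    using Tstar_T_chain[OF v, of j] j by simp
  then have "cinner (T_op *v chain \<alpha> v j) (T_op *v chain \<alpha> v j) = 0"
    unfolding cinner_T_op by (simp add: cinner_def)
  then show ?thesis by (simp add: cinner_self_eq_0)
qed

text \<open>Moving T across the inner product lowers both chains together. If one reaches its
  primitive vector first, \<open>Tstar_op\<close> annihilates it; if both do so together, different
  levels are orthogonal and equal levels leave the product of v and w.\<close>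

lemma cinner_chain:
  fixes v w :: "complex ^ ('n::finite set)"
  assumes v: "v \<in> primitive \<alpha>" and w: "w \<in> primitive \<beta>"
    and "j + 2 * \<alpha> \<le> CARD('n)" "l + 2 * \<beta> \<le> CARD('n)"
  shows "cinner (chain \<alpha> v j) (chain \<beta> w l) = (if \<alpha> = \<beta> \<and> j = l then cinner v w else 0)"
  using assms(3,4)
proof (induction j arbitrary: l)
  case 0
  show ?case
  proof (cases l)
    case 0
    then show ?thesis using v w cinner_level_neq[of v \<alpha> w \<beta>] by (auto simp: primitive_def)
  next
    case (Suc l')
    have "cinner (chain \<beta> w (Suc l')) v = 0"
      unfolding chain.simps(2) cinner_scale_left cinner_T_op
      using v by (simp add: primitive_def cinner_def)
    then show ?thesis using Suc cinner_commute[of v] by simp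
  qed
next
  case (Suc j)
  let ?t = "ladder CARD('n)"
  have pos: "?t \<alpha> j > 0" using Suc.prems by (intro ladder_pos) simp
  show ?case
  proof (cases l)
    case 0
    have "cinner (chain \<alpha> v (Suc j)) w = 0"
      unfolding chain.simps(2) cinner_scale_left cinner_T_op
      using w by (simp add: primitive_def cinner_def)
    then show ?thesis using 0 by simp
  next
    case l: (Suc l')
    have "cinner (chain \<alpha> v (Suc j)) (chain \<beta> w (Suc l'))
        = (1 / complex_of_real (?t \<alpha> j)) * cinner (chain \<alpha> v j) (Tstar_op *v chain \<beta> w (Suc l'))"
      unfolding chain.simps(2)[of \<alpha>] cinner_scale_left cinner_T_op ..
    also have "\<dots> = (complex_of_real (?t \<beta> l') / complex_of_real (?t \<alpha> j)) * cinner (chain \<alpha> v j) (chain \<beta> w l')"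
      using Suc.prems l by (subst Tstar_chain[OF w]) (simp_all add: cinner_scale_right)
    \<comment> \<open>For \<alpha> = \<beta> and j = l' the quotient of ladder coefficients is 1; in
      all other cases the induction hypothesis gives 0.\<close>
    finally show ?thesis
      using Suc l pos by (auto simp del: chain.simps)
  qed
qed

text \<open>Each linear equation lowers the dimension by at most one, so fewer equations than
  dimensions leave a nonzero solution.\<close>

lemma exists_nonzero_solution:
  fixes S :: "(complex ^ 'm::finite) set"
  assumes "finite E" and "vec.subspace S"
    and "\<And>e v w. e \<in> E \<Longrightarrow> f e (v + w) = f e v + f e w"
    and "\<And>e c v. e \<in> E \<Longrightarrow> f e (c *s v) = (c * f e v :: complex)"
    and "card E < vec.dim S"
  obtains v where "v \<in> S" "v \<noteq> 0" "\<And>e. e \<in> E \<Longrightarrow> f e v = 0"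
proof -
  have "\<exists>v\<in>S. v \<noteq> 0 \<and> (\<forall>e\<in>E. f e v = 0)"
    using assms
  proof (induction E arbitrary: S rule: finite_induct)
    case empty
    have "vec.dim S \<noteq> 0" using empty.prems(4) by (simp del: vec.dim_eq_0)
    then have "\<not> S \<subseteq> {0}" by simp
    then show ?case by auto
  next
    case (insert e E)
    have add: "f e (v + w) = f e v + f e w" and scale: "f e (c *s v) = c * f e v" for v w c
      using insert.prems by auto
    let ?S = "{v \<in> S. f e v = 0}"
    have sub: "vec.subspace ?S"
      using insert.prems(1) scale[of 0 0] unfolding vec.subspace_def by (auto simp: add scale)
    have "vec.dim S \<le> vec.dim ?S + 1"
    proof (cases "S = ?S")
      case False
      then obtain w where w: "w \<in> S" "f e w \<noteq> 0" by blast
      have "S \<subseteq> vec.span (insert w ?S)"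
      proof
        fix v assume v: "v \<in> S"
        \<comment> \<open>The multiple of w that moves v into the kernel; thus w together with the
          kernel spans S.\<close>
        let ?c = "f e v / f e w"
        have "v + (- ?c) *s w \<in> S"
          using v w insert.prems(1) by (intro vec.subspace_add vec.subspace_scale) auto
        moreover have "f e (v + (- ?c) *s w) = 0"
          unfolding add scale using w by simp
        ultimately have "v + (- ?c) *s w \<in> ?S" by simp
        then have "v + (- ?c) *s w + ?c *s w \<in> vec.span (insert w ?S)"
          by (intro vec.span_add vec.span_scale vec.span_base) auto
        then show "v \<in> vec.span (insert w ?S)" by simp
      qed
      then have "vec.dim S \<le> vec.dim (insert w ?S)"
        using vec.dim_subset vec.dim_span by metis
      then show ?thesis by (auto simp: vec.dim_insert split: if_splits)
    qed simp
    then have "card E < vec.dim ?S" using insert by simp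
    then have "\<exists>v\<in>?S. v \<noteq> 0 \<and> (\<forall>e\<in>E. f e v = 0)"
      using insert.prems by (intro insert.IH[OF sub]) auto
    then show ?case by auto
  qed
  then show thesis using that by blast
qed

section \<open>Counting primitive vectors\<close>

lemma card_sets_of_size: "card {I :: 'n::finite set. card I = r} = CARD('n) choose r"
  using n_subsets[of "UNIV :: 'n set" r] by simp

lemma subspace_level: "vec.subspace (level r)"
  by (auto simp: vec.subspace_def level_def)

lemma dim_level: "CARD('n) choose r \<le> vec.dim (level r :: (complex ^ ('n::finite set)) set)"
proof -
  let ?B = "(\<lambda>I. axis I 1 :: complex ^ ('n set)) ` {I. card I = r}"
  have "?B \<subseteq> cart_basis" by (auto simp: cart_basis_def)
  then have "vec.independent ?B" using independent_cart_basis vec.independent_mono by blast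
  then have "vec.dim ?B = card ?B" by (rule vec.dim_eq_card_independent)
  also have "\<dots> = CARD('n) choose r"
    by (subst card_image) (auto simp: inj_on_def axis_eq_axis card_sets_of_size)
  finally have "CARD('n) choose r = vec.dim ?B" ..
  also have "\<dots> \<le> vec.dim (level r :: (complex ^ ('n set)) set)"
    by (rule vec.dim_subset) (auto simp: level_def axis_def)
  finally show ?thesis .
qed

text \<open>The next vector has to satisfy (n choose \<alpha>-1) equations for primitivity and m for
  orthogonality. As long as m is below the multiplicity, these are fewer than the (n choose
  \<alpha>) unknowns of the level.\<close>

lemma orthonormal_primitive:
  assumes "m \<le> comp_mult CARD('n) \<alpha>"
  shows "\<exists>b :: nat \<Rightarrow> complex ^ ('n::finite set). (\<forall>k<m. b k \<in> primitive \<alpha>) \<and>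
    (\<forall>k<m. \<forall>l<m. cinner (b k) (b l) = (if k = l then 1 else 0))"
  using assms
proof (induction m)
  case (Suc m)
  then obtain b :: "nat \<Rightarrow> complex ^ ('n set)" where b: "\<And>k. k < m \<Longrightarrow> b k \<in> primitive \<alpha>"
    "\<And>k l. k < m \<Longrightarrow> l < m \<Longrightarrow> cinner (b k) (b l) = (if k = l then 1 else 0)"
    using Suc.IH[OF Suc_leD[OF Suc.prems]] by blast
  \<comment> \<open>\<open>Inl J\<close> names the equation for coordinate J of
    \<open>Tstar_op *v v\<close>, and \<open>Inr k\<close> the orthogonality to \<open>b k\<close>.
    Writing \<open>Suc (card J)\<close> yields no equations of the first kind for \<alpha> =
    0.\<close>
  let ?E = "Inl ` {J :: 'n set. Suc (card J) = \<alpha>} \<union> Inr ` {..<m}"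
  define f where "f e v = (case e of Inl J \<Rightarrow> (Tstar_op *v v) $ J | Inr k \<Rightarrow> cinner v (b k))"
    for e and v :: "complex ^ ('n set)"
  have "card {J :: 'n set. Suc (card J) = \<alpha>} = (if \<alpha> = 0 then 0 else CARD('n) choose (\<alpha> - 1))"
    by (cases \<alpha>) (simp_all add: card_sets_of_size)
  moreover have "card ?E = card {J :: 'n set. Suc (card J) = \<alpha>} + m"
    by (subst card_Un_disjoint) (auto simp: card_image)
  ultimately have "card ?E < CARD('n) choose \<alpha>"
    using Suc.prems by (simp add: comp_mult_def)
  then have card: "card ?E < vec.dim (level \<alpha> :: (complex ^ ('n set)) set)"
    using dim_level by (rule less_le_trans)
  have lin: "f e (v + w) = f e v + f e w" "f e (c *s v) = c * f e v" for e v w c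
    by (auto simp: f_def cinner_def vec.add vec.scale sum.distrib sum_distrib_left algebra_simps split: sum.split)
  obtain v where v: "v \<in> level \<alpha>" "v \<noteq> 0" "\<And>e. e \<in> ?E \<Longrightarrow> f e v = 0"
    by (rule exists_nonzero_solution[of ?E "level \<alpha>" f, OF _ subspace_level lin card]) auto
  \<comment> \<open>Coordinates one level below \<alpha> vanish by the equations, all others because
    v lies in the level.\<close>
  have "(Tstar_op *v v) $ J = 0" for J
  proof (cases "Suc (card J) = \<alpha>")
    case True
    then show ?thesis using v(3)[of "Inl J"] by (auto simp: f_def)
  next
    case False
    then show ?thesis using v(1) by (auto simp: Tstar_op_nth level_def intro!: sum.neutral)
  qed
  then have prim: "v \<in> primitive \<alpha>" using v(1) by (simp add: primitive_def vec_eq_iff)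
  have orth: "cinner v (b k) = 0" if "k < m" for k
    using v(3)[of "Inr k"] that by (auto simp: f_def)
  define s where "s = (\<Sum>i\<in>UNIV. (norm (v $ i))\<^sup>2)"
  have s: "cinner v v = of_real s" by (simp add: s_def cinner_self)
  have "s \<noteq> 0" using s v(2) cinner_self_eq_0[of v] by auto
  moreover have "s \<ge> 0" by (simp add: s_def sum_nonneg)
  ultimately have "s > 0" by simp
  define w where "w = (1 / complex_of_real (sqrt s)) *s v"
  have w: "cinner w w = 1"
    using \<open>s > 0\<close> by (simp add: w_def cinner_scale_left cinner_scale_right s flip: of_real_mult)
  have w_prim: "w \<in> primitive \<alpha>"
    using prim by (simp add: w_def primitive_def level_scale vec.scale)
  have w_orth: "cinner w (b k) = 0" "cinner (b k) w = 0" if "k < m" for k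
    using orth[OF that] cinner_commute[of "b k" v] by (simp_all add: w_def cinner_scale_left cinner_scale_right)
  show ?case
    by (intro exI[of _ "b(m := w)"]) (auto simp: less_Suc_eq b w w_prim w_orth)
qed simp

section \<open>The algebra generated by the raising and lowering operators\<close>

text \<open>With \<alpha> eliminated by the weight, the difference of the two eigenvalues of
  \<open>T_op ** Tstar_op\<close> has the factor j - l, and the cofactor is positive within the
  range of the chains.\<close>

lemma weight_casimir_separates:
  fixes n \<alpha> \<beta> j l :: nat
  assumes "j + 2 * \<alpha> \<le> n" "l + 2 * \<beta> \<le> n"
    and casimir: "real j * (real n - 2 * real \<alpha> - real j + 1) = real l * (real n - 2 * real \<beta> - real l + 1)"
    and weight: "\<alpha> + j = \<beta> + l"
  shows "\<alpha> = \<beta> \<and> j = l"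
proof -
  have \<alpha>: "real \<alpha> = real \<beta> + real l - real j" using weight by linarith
  have "(real j - real l) * (real n - 2 * real \<beta> - 2 * real l + real j + real l + 1) = 0"
    using casimir unfolding \<alpha> by (simp add: algebra_simps)
  moreover have "real n - 2 * real \<beta> - 2 * real l + real j + real l + 1 > 0"
    using assms(2) by (simp flip: of_nat_le_iff)
  ultimately show ?thesis using weight by auto
qed

lemma generated_algebra_unital: "unital_subalgebra (generated_algebra S)"
  unfolding generated_algebra_def by (rule hull_in) (auto simp: unital_subalgebra_def)

theorem mainTheorem5:
  fixes n :: nat and \<A> :: "(complex ^ ('n::finite set) ^ ('n set)) set"
  assumes n: "n = CARD('n)"
    and \<A>: "\<A> = generated_algebra {T_op, Tstar_op}"
  shows "star_algebra \<A>
    \<and> decomposes_as \<A> {0..n div 2} (comp_degree n) (comp_mult n)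
    \<and> comp_mult n 0 = 1
    \<and> (algebra_degree \<A> = (\<Sum>\<alpha>=0..n div 2. comp_mult n \<alpha> * comp_degree n \<alpha>)
       \<and> (\<Sum>\<alpha>=0..n div 2. comp_mult n \<alpha> * comp_degree n \<alpha>) = 2 ^ n)
    \<and> (cmat.dim \<A> = (\<Sum>\<alpha>=0..n div 2. (comp_degree n \<alpha>)\<^sup>2)
       \<and> (\<Sum>\<alpha>=0..n div 2. (comp_degree n \<alpha>)\<^sup>2) = (n + 3) choose 3)
    \<and> cmat.dim (center \<A>) = 1 + n div 2
    \<and> (cmat.dim (centralizer \<A>) = (\<Sum>\<alpha>=0..n div 2. (comp_mult n \<alpha>)\<^sup>2)
       \<and> real (\<Sum>\<alpha>=0..n div 2. (comp_mult n \<alpha>)\<^sup>2) = 1 / (real n + 1) * real ((2 * n) choose n)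
       \<and> 1 / (real n + 1) * real ((2 * n) choose n) = real (catalan n))"
proof -
  let ?K = "{0..n div 2}" and ?d = "comp_degree n" and ?m = "comp_mult n"
  let ?I = "block_index ?K ?d ?m"
  \<comment> \<open>Restates the degree bound without truncated subtraction, as the chain lemmas
    need it.\<close>
  have deg: "j < ?d \<alpha> \<longleftrightarrow> j + 2 * \<alpha> \<le> n" if "\<alpha> \<in> ?K" for \<alpha> j
    using that by (auto simp: comp_degree_def)
  have "\<forall>\<alpha>. \<exists>b :: nat \<Rightarrow> complex ^ ('n set). (\<forall>k<?m \<alpha>. b k \<in> primitive \<alpha>) \<and>
    (\<forall>k<?m \<alpha>. \<forall>l<?m \<alpha>. cinner (b k) (b l) = (if k = l then 1 else 0))"
    using orthonormal_primitive n by blast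
  then obtain b :: "nat \<Rightarrow> nat \<Rightarrow> complex ^ ('n set)"
    where b: "\<And>\<alpha> k. k < ?m \<alpha> \<Longrightarrow> b \<alpha> k \<in> primitive \<alpha>"
      "\<And>\<alpha> k l. k < ?m \<alpha> \<Longrightarrow> l < ?m \<alpha> \<Longrightarrow> cinner (b \<alpha> k) (b \<alpha> l) = (if k = l then 1 else 0)"
    by metis
  define u where "u = (\<lambda>(\<alpha>, j, k). chain \<alpha> (b \<alpha> k) j)"
  have orth: "cinner (u x) (u y) = (if x = y then 1 else 0)" if "x \<in> ?I" "y \<in> ?I" for x y
  proof -
    obtain \<alpha> j k where x: "x = (\<alpha>, j, k)" "\<alpha> \<in> ?K" "j < ?d \<alpha>" "k < ?m \<alpha>"
      using \<open>x \<in> ?I\<close> by (auto simp: block_index_def)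
    obtain \<beta> l k' where y: "y = (\<beta>, l, k')" "\<beta> \<in> ?K" "l < ?d \<beta>" "k' < ?m \<beta>"
      using \<open>y \<in> ?I\<close> by (auto simp: block_index_def)
    have "cinner (u x) (u y) = (if \<alpha> = \<beta> \<and> j = l then cinner (b \<alpha> k) (b \<beta> k') else 0)"
      unfolding x(1) y(1) u_def prod.case
      using x y deg n by (intro cinner_chain b) simp_all
    then show ?thesis using b(2)[of k \<alpha> k'] x y by auto
  qed
  have "card ?I = (\<Sum>\<alpha>\<in>?K. ?m \<alpha> * ?d \<alpha>)"
    unfolding block_index_def by (subst card_SigmaI) (auto simp: card_cartesian_product mult.commute)
  \<comment> \<open>The degree identity shows that the chains supply as many vectors as the
    dimension of V, so they form a basis.\<close>
  then have card: "card ?I = CARD('n set)"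
    by (simp add: sum_mult_degree n card_Pow flip: Pow_UNIV)
  obtain \<phi> :: "'n set \<Rightarrow> nat \<times> nat \<times> nat" and U where \<phi>: "bij_betw \<phi> UNIV ?I" and U: "unitary U"
    and coord: "\<And>X r c. conj_by (adj U) X $ r $ c = cinner (X *v u (\<phi> c)) (u (\<phi> r))"
    using orthonormal_frame[OF card orth] by blast
  interpret block_frame \<phi> ?K ?d ?m U
    by unfold_locales (auto simp: \<phi> U comp_mult_pos[simplified] comp_degree_def)
  define up where "up \<alpha> j j' = (if j = Suc j' then complex_of_real (ladder n \<alpha> j') else 0)" for \<alpha> j j'
  have "conj_by (adj U) T_op = block_matrix \<phi> up"
  proof (rule matrix_eqI)
    fix \<alpha> j k \<beta> l k'
    assume A: "\<alpha> \<in> ?K" "j < ?d \<alpha>" "k < ?m \<alpha>" "\<beta> \<in> ?K" "l < ?d \<beta>" "k' < ?m \<beta>"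
    have "conj_by (adj U) T_op $ \<psi> (\<alpha>, j, k) $ \<psi> (\<beta>, l, k')
        = cinner (T_op *v chain \<beta> (b \<beta> k') l) (u (\<alpha>, j, k))"
      using A by (simp add: coord) (simp add: u_def)
    \<comment> \<open>Below the top, T moves to the next chain vector. At the top it gives 0, in
      agreement with \<open>up\<close>, since the row l + 1 would leave the block.\<close>
    also have "\<dots> = (if \<alpha> = \<beta> \<and> k = k' then up \<alpha> j l else 0)"
    proof (cases "l + 2 * \<beta> < n")
      case True
      then have "Suc l < ?d \<beta>" using A deg by simp
      then have "cinner (u (\<beta>, Suc l, k')) (u (\<alpha>, j, k)) = (if (\<beta>, Suc l, k') = (\<alpha>, j, k) then 1 else 0)"
        using A by (intro orth) (auto simp: block_index_def)
      moreover have "T_op *v chain \<beta> (b \<beta> k') l = complex_of_real (ladder n \<beta> l) *s u (\<beta>, Suc l, k')"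
        using True T_chain[of l \<beta> "b \<beta> k'"] by (simp add: u_def n del: chain.simps)
      ultimately show ?thesis
        by (auto simp: cinner_scale_left up_def)
    next
      case False
      then have top: "l + 2 * \<beta> = n" using A deg[of \<beta> l] by simp
      then have "T_op *v chain \<beta> (b \<beta> k') l = 0" using A b n by (intro T_chain_top) auto
      moreover have "j \<noteq> Suc l" if "\<alpha> = \<beta>" using that top A deg[of \<beta> j] by auto
      ultimately show ?thesis by (auto simp: up_def)
    qed
    finally show "conj_by (adj U) T_op $ \<psi> (\<alpha>, j, k) $ \<psi> (\<beta>, l, k')
        = block_matrix \<phi> up $ \<psi> (\<alpha>, j, k) $ \<psi> (\<beta>, l, k')"
      using A by (simp add: block_matrix_nth)
  qed
  then have T: "T_op = block_op up"
    using conj_by_inverse[OF U, of T_op] by (simp add: block_op_def)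
  define down where "down \<alpha> j j' = cnj (up \<alpha> j' j)" for \<alpha> j j'
  have Tstar: "Tstar_op = block_op down"
    unfolding Tstar_op_eq_adj T adj_block_op down_def ..
  \<comment> \<open>The squared coefficient of the step from j - 1 to j; the factor j also gives the
    correct value 0 at the bottom.\<close>
  have TTstar: "T_op ** Tstar_op = diag (\<lambda>\<alpha> j. of_real (real j * (real n - 2 * real \<alpha> - real j + 1)))"
    unfolding T Tstar block_op_mult diag_def
  proof (rule block_op_cong)
    fix \<alpha> j j' assume A: "\<alpha> \<in> ?K" "j < ?d \<alpha>" "j' < ?d \<alpha>"
    show "(\<Sum>l<?d \<alpha>. up \<alpha> j l * down \<alpha> l j')
        = (if j = j' then of_real (real j * (real n - 2 * real \<alpha> - real j + 1)) else 0)"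
    proof (cases j)
      case (Suc i)
      have "(\<Sum>l<?d \<alpha>. up \<alpha> j l * down \<alpha> l j')
          = (\<Sum>l<?d \<alpha>. if l = i then if j = j' then of_real ((ladder n \<alpha> i)\<^sup>2) else 0 else 0)"
        unfolding Suc by (intro sum.cong refl) (auto simp: up_def down_def power2_eq_square)
      also have "\<dots> = (if j = j' then of_real ((ladder n \<alpha> i)\<^sup>2) else 0)"
        using A Suc by simp
      also have "(ladder n \<alpha> i)\<^sup>2 = real j * (real n - 2 * real \<alpha> - real j + 1)"
        using A deg[of \<alpha> j] Suc by (simp add: ladder_square)
      finally show ?thesis .
    qed (auto simp: up_def down_def)
  qed
  have TstarT: "Tstar_op ** T_op = diag (\<lambda>\<alpha> j. of_real (real (Suc j) * (real n - 2 * real \<alpha> - real j)))"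
    unfolding T Tstar block_op_mult diag_def
  proof (rule block_op_cong)
    fix \<alpha> j j' assume A: "\<alpha> \<in> ?K" "j < ?d \<alpha>" "j' < ?d \<alpha>"
    have "(\<Sum>l<?d \<alpha>. down \<alpha> j l * up \<alpha> l j')
        = (\<Sum>l<?d \<alpha>. if l = Suc j then if j = j' then of_real ((ladder n \<alpha> j)\<^sup>2) else 0 else 0)"
      by (intro sum.cong refl) (auto simp: up_def down_def power2_eq_square)
    also have "\<dots> = (if Suc j < ?d \<alpha> then if j = j' then of_real ((ladder n \<alpha> j)\<^sup>2) else 0 else 0)"
      by simp
    also have "\<dots> = (if j = j' then of_real ((ladder n \<alpha> j)\<^sup>2) else 0)"
    proof -
      \<comment> \<open>In the last row the index \<open>Suc j\<close> leaves the block and the sum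
        is empty of contributions, which matches the vanishing coefficient.\<close>
      have "ladder n \<alpha> j = 0" if "\<not> Suc j < ?d \<alpha>"
      proof -
        have "n = j + 2 * \<alpha>" using that A deg[of \<alpha>] by auto
        then show ?thesis by (simp add: ladder_def)
      qed
      then show ?thesis by auto
    qed
    finally show "(\<Sum>l<?d \<alpha>. down \<alpha> j l * up \<alpha> l j')
        = (if j = j' then of_real (real (Suc j) * (real n - 2 * real \<alpha> - real j)) else 0)"
      using A deg[of \<alpha> j] by (simp add: ladder_square)
  qed
  have alg: "unital_subalgebra \<A>" unfolding \<A> by (rule generated_algebra_unital)
  have gen: "T_op \<in> \<A>" "Tstar_op \<in> \<A>" unfolding \<A> generated_algebra_def by (auto intro: hull_inc)
  have prods: "T_op ** Tstar_op \<in> \<A>" "Tstar_op ** T_op \<in> \<A>"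
    using alg gen by (auto simp: unital_subalgebra_def)
  have "range block_op \<subseteq> \<A>"
  proof (rule range_block_op_subset[OF alg, of up down])
    fix \<alpha> j \<beta> l
    assume A: "\<alpha> \<in> ?K" "j < ?d \<alpha>" "\<beta> \<in> ?K" "l < ?d \<beta>" "(\<alpha>, j) \<noteq> (\<beta>, l)"
    show "\<exists>f. diag f \<in> \<A> \<and> f \<alpha> j \<noteq> f \<beta> l"
    proof (cases "real j * (real n - 2 * real \<alpha> - real j + 1) = real l * (real n - 2 * real \<beta> - real l + 1)")
      case True
      have "real (Suc j) * (real n - 2 * real \<alpha> - real j) \<noteq> real (Suc l) * (real n - 2 * real \<beta> - real l)"
      proof
        \<comment> \<open>The eigenvalues of \<open>Tstar_op ** T_op\<close> and
          \<open>T_op ** Tstar_op\<close> differ by the weight n - 2(\<alpha> + j). If both agree at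
          the two pairs, so do the weights, and the pairs coincide.\<close>
        assume "real (Suc j) * (real n - 2 * real \<alpha> - real j) = real (Suc l) * (real n - 2 * real \<beta> - real l)"
        with True have "real (\<alpha> + j) = real (\<beta> + l)"
          by (simp add: algebra_simps)
        then have "\<alpha> + j = \<beta> + l" by (simp only: of_nat_eq_iff)
        with True A deg show False
          using weight_casimir_separates[of j \<alpha> n l \<beta>] by simp
      qed
      then show ?thesis
        using prods(2) unfolding TstarT of_real_eq_iff[symmetric, where ?'a = complex] by blast
    next
      case False
      then show ?thesis
        using prods(1) unfolding TTstar of_real_eq_iff[symmetric, where ?'a = complex] by blast
    qed
  next
    show "block_op up \<in> \<A>" "block_op down \<in> \<A>" using gen T Tstar by simp_all
  next
    fix \<alpha> j assume "\<alpha> \<in> ?K" "Suc j < ?d \<alpha>"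
    then have "ladder n \<alpha> j > 0" using deg[of \<alpha> "Suc j"] by (intro ladder_pos) simp
    then show "up \<alpha> (Suc j) j \<noteq> 0" "down \<alpha> j (Suc j) \<noteq> 0"
      by (simp_all add: up_def down_def)
  qed
  \<comment> \<open>The block algebra is a unital algebra containing both generators, so minimality
    of the hull applies. Closure under adjoints then follows from the equality.\<close>
  moreover have "\<A> \<subseteq> range block_op"
    unfolding \<A> generated_algebra_def
    using star_algebra_range_block_op by (intro hull_minimal) (auto simp: T Tstar star_algebra_def)
  ultimately have \<A>_eq: "\<A> = range block_op" by blast
  have "decomposes_as \<A> ?K ?d ?m"
    unfolding \<A>_eq by (rule decomposes_as_range_block_op)
  moreover have "star_algebra \<A>" unfolding \<A>_eq by (rule star_algebra_range_block_op)
  moreover have "?m 0 = 1" by (simp add: comp_mult_def)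
  moreover have "cmat.dim \<A> = (\<Sum>\<alpha>=0..n div 2. (?d \<alpha>)\<^sup>2)" unfolding \<A>_eq by (rule dim_range_block_op)
  moreover have "cmat.dim (center \<A>) = 1 + n div 2" unfolding \<A>_eq by (simp add: dim_center)
  moreover have "cmat.dim (centralizer \<A>) = (\<Sum>\<alpha>=0..n div 2. (?m \<alpha>)\<^sup>2)"
    unfolding \<A>_eq by (rule dim_centralizer)
  ultimately show ?thesis
    using algebra_degree_eq sum_mult_degree sum_degree_squares sum_mult_squares catalan_closed
    by metis
qed

end
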